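(* Let $P^*$ be an order-preserving semiflow on $\mathcal P_2(\mathbb{R})$. Assume that there exist a positively invariant bounded open set $B\subset\mathcal P_2(\mathbb{R})$ and an order bounded closed set $K\subset\mathcal P_2(\mathbb{R})$ such that $K$ attracts $B$. Assume further that there is only one invariant measure $\mu_0$ in $\overline B$. Then: (i) If $\mu_0\ge_{\mathrm{st}}\omega(B)$ and there exists another invariant measure $\mu_{-1}<_{\mathrm{st}}\mu_0$ with an increasing connecting orbit $\{\nu_t^{-1,0}\}_{t\in\mathbb{R}}$ from $\mu_{-1}$ to $\mu_0$ such that $\nu_{t_{-1}}^{-1,0}\le_{\mathrm{st}}\omega(B)$ for some $t_{-1}\in\mathbb{R}$, then $\mu_0$ attracts $B$. (ii) If $\mu_0\le_{\mathrm{st}}\omega(B)$ and there exists another invariant measure $\mu_1>_{\mathrm{st}}\mu_0$ with a decreasing connecting orbit $\{\nu_t^{1,0}\}_{t\in\mathbb{R}}$ from $\mu_1$ to $\mu_0$ such that $\nu_{t_1}^{1,0}\ge_{\mathrm{st}}\omega(B)$ for some $t_1\in\mathbb{R}$, then $\mu_0$ attracts $B$. (iii) If there exist another two invariant measures $\mu_{-1}<_{\mathrm{st}}\mu_0$ and $\mu_1>_{\mathrm{st}}\mu_0$ with an increasing connecting orbit $\{\nu_t^{-1,0}\}_{t\in\mathbb{R}}$ from $\mu_{-1}$ to $\mu_0$ and a decreasing connecting orbit $\{\nu_t^{1,0}\}_{t\in\mathbb{R}}$ from $\mu_1$ to $\mu_0$ such that $\nu_{t_{-1}}^{-1,0}\le_{\mathrm{st}}\omega(B)$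 for some $t_{-1}\in\mathbb{R}$ and $\nu_{t_1}^{1,0}\ge_{\mathrm{st}}\omega(B)$ for some $t_1\in\mathbb{R}$, then $\mu_0$ attracts $B$.
   Context: $\mathcal P_2(\mathbb{R})$ is the set of Borel probability measures on $\mathbb{R}$ with finite second moment, with the 2-Wasserstein metric $\mathcal W_2$ (topological notions refer to this metric). For sets, $\mathcal W_2(A,B):=\sup_{\mu\in A}\inf_{\nu\in B}\mathcal W_2(\mu,\nu)$. Stochastic order: $\mu\le_{\mathrm{st}}\nu$ iff $\int f\,\mathrm d\mu\le\int f\,\mathrm d\nu$ for all bounded increasing (non-decreasing) $f:\mathbb{R}\to\mathbb{R}$; $\mu<_{\mathrm{st}}\nu$ means $\mu\le_{\mathrm{st}}\nu$ and $\mu\ne\nu$; for a set $A$, $\mu\le_{\mathrm{st}}A$ (resp. $\mu\ge_{\mathrm{st}}A$) means $\mu\le_{\mathrm{st}}\rho$ (resp. $\mu\ge_{\mathrm{st}}\rho$) for all $\rho\in A$. A set is order bounded if it has both an upper and a lower bound in $\mathcal P_2(\mathbb{R})$ for $\le_{\mathrm{st}}$. A semiflow on $\mathcal P_2(\mathbb{R})$ is a (jointly) continuous map $P^*:\mathbb{R}_+\times\mathcal P_2(\mathbb{R})\to\mathcal P_2(\mathbb{R})$, $(t,\mu)\mapsto P_t^*\mu$, with $P_0^*=\mathrm{id}$ and $P_t^*\circ P_s^*=P_{t+s}^*$. It is order-preserving if $\mu\le_{\mathrm{st}}\nu$ implies $P_t^*\mu\le_{\mathrm{st}}P_t^*\nu$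 for all $t>0$. $\nu$ is an invariant measure if $P_t^*\nu=\nu$ for all $t\ge0$. A set $A$ is positively invariant if $P_t^*A\subset A$ for all $t\ge0$. A set $K$ (or measure, identified with a singleton) attracts a set $B$ if $\mathcal W_2(P_t^*B,K)\to0$ as $t\to\infty$. $\omega(B):=\bigcap_{s\ge0}\overline{\bigcup_{t\ge s}P_t^*B}$. A connecting orbit from an invariant measure $\nu$ to another invariant measure $\tilde\nu$ is a family $\{\nu_t\}_{t\in\mathbb{R}}\subset\mathcal P_2(\mathbb{R})$ with $P_t^*\nu_s=\nu_{t+s}$ for all $t\ge0$, $s\in\mathbb{R}$, $\mathcal W_2(\nu_t,\nu)\to0$ as $t\to-\infty$ and $\mathcal W_2(\nu_t,\tilde\nu)\to0$ as $t\to\infty$. It is increasing (decreasing) if $\nu_s\le_{\mathrm{st}}\nu_t$ ($\nu_s\ge_{\mathrm{st}}\nu_t$) for all $s\le t$. *)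

theory Defs
  imports "HOL-Probability.Probability"
begin

section \<open>The Wasserstein space over the real line\<close>

definition P2 :: "real measure set" where
  "P2 = {\<mu>. prob_space \<mu> \<and> sets \<mu> = sets borel \<and> integrable \<mu> (\<lambda>x. x\<^sup>2)}"

definition couplings :: "real measure \<Rightarrow> real measure \<Rightarrow> (real \<times> real) measure set" where
  "couplings \<mu> \<nu> = {\<pi>. prob_space \<pi> \<and> sets \<pi> = sets (borel \<Otimes>\<^sub>M borel) \<and>
     distr \<pi> borel fst = \<mu> \<and> distr \<pi> borel snd = \<nu>}"

text \<open>The infimum is taken in \<^typ>\<open>ennreal\<close>; on \<^const>\<open>P2\<close> it is finite, so that
  \<^const>\<open>enn2real\<close> loses nothing there.\<close>

definition W2 :: "real measure \<Rightarrow> real measure \<Rightarrow> real" where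
  "W2 \<mu> \<nu> = sqrt (enn2real
     (INF \<pi>\<in>couplings \<mu> \<nu>. \<integral>\<^sup>+ (x, y). ennreal ((x - y)\<^sup>2) \<partial>\<pi>))"

text \<open>These locale constants describe the metric topology and the metrically bounded subsets because
  \<open>Metric_space P2 W2\<close> holds; stating them does not need a proof of this classical fact.\<close>

abbreviation W2_topology :: "real measure topology" where
  "W2_topology \<equiv> Metric_space.mtopology P2 W2"

abbreviation W2_bounded :: "real measure set \<Rightarrow> bool" where
  "W2_bounded \<equiv> Metric_space.mbounded P2 W2"

text \<open>The one-sided distance between sets. It is extended-valued, so that the supremum over an
  unbounded set and the infimum over the empty set are both \<open>\<infinity>\<close>.\<close>

definition W2_sets :: "real measure set \<Rightarrow> real measure set \<Rightarrow> ennreal" where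
  "W2_sets A B = (SUP \<mu>\<in>A. INF \<nu>\<in>B. ennreal (W2 \<mu> \<nu>))"

section \<open>Stochastic order\<close>

text \<open>Monotone functions are Borel measurable, so the bounded ones are integrable with respect to
  every Borel probability measure.\<close>

definition st_le :: "real measure \<Rightarrow> real measure \<Rightarrow> bool" (infix "\<le>\<^sub>s\<^sub>t" 50) where
  "\<mu> \<le>\<^sub>s\<^sub>t \<nu> \<longleftrightarrow> (\<forall>f :: real \<Rightarrow> real. mono f \<and> bounded (range f) \<longrightarrow>
     integral\<^sup>L \<mu> f \<le> integral\<^sup>L \<nu> f)"

definition st_less :: "real measure \<Rightarrow> real measure \<Rightarrow> bool" (infix "<\<^sub>s\<^sub>t" 50) where
  "\<mu> <\<^sub>s\<^sub>t \<nu> \<longleftrightarrow> \<mu> \<le>\<^sub>s\<^sub>t \<nu> \<and> \<mu> \<noteq> \<nu>"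

definition st_lower_bound :: "real measure \<Rightarrow> real measure set \<Rightarrow> bool" where
  "st_lower_bound \<mu> A \<longleftrightarrow> (\<forall>\<rho>\<in>A. \<mu> \<le>\<^sub>s\<^sub>t \<rho>)"

definition st_upper_bound :: "real measure \<Rightarrow> real measure set \<Rightarrow> bool" where
  "st_upper_bound \<mu> A \<longleftrightarrow> (\<forall>\<rho>\<in>A. \<rho> \<le>\<^sub>s\<^sub>t \<mu>)"

definition order_bounded :: "real measure set \<Rightarrow> bool" where
  "order_bounded A \<longleftrightarrow> (\<exists>\<mu>\<in>P2. st_lower_bound \<mu> A) \<and> (\<exists>\<mu>\<in>P2. st_upper_bound \<mu> A)"

section \<open>Semiflows\<close>

text \<open>A semiflow is a total function whose values matter only for times in \<open>{0..}\<close> and measures in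
  \<^const>\<open>P2\<close>. That it maps \<^const>\<open>P2\<close> into itself is part of \<^const>\<open>continuous_map\<close>.\<close>

definition semiflow :: "(real \<Rightarrow> real measure \<Rightarrow> real measure) \<Rightarrow> bool" where
  "semiflow P \<longleftrightarrow>
     continuous_map (prod_topology (top_of_set {0..}) W2_topology) W2_topology
       (\<lambda>(t, \<mu>). P t \<mu>) \<and>
     (\<forall>\<mu>\<in>P2. P 0 \<mu> = \<mu>) \<and>
     (\<forall>t\<ge>0. \<forall>s\<ge>0. \<forall>\<mu>\<in>P2. P t (P s \<mu>) = P (t + s) \<mu>)"

definition order_preserving :: "(real \<Rightarrow> real measure \<Rightarrow> real measure) \<Rightarrow> bool" where
  "order_preserving P \<longleftrightarrow>
     (\<forall>\<mu>\<in>P2. \<forall>\<nu>\<in>P2. \<mu> \<le>\<^sub>s\<^sub>t \<nu> \<longrightarrow> (\<forall>t>0. P t \<mu> \<le>\<^sub>s\<^sub>t P t \<nu>))"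

definition invariant_measure ::
    "(real \<Rightarrow> real measure \<Rightarrow> real measure) \<Rightarrow> real measure \<Rightarrow> bool" where
  "invariant_measure P \<nu> \<longleftrightarrow> \<nu> \<in> P2 \<and> (\<forall>t\<ge>0. P t \<nu> = \<nu>)"

definition positively_invariant ::
    "(real \<Rightarrow> real measure \<Rightarrow> real measure) \<Rightarrow> real measure set \<Rightarrow> bool" where
  "positively_invariant P A \<longleftrightarrow> (\<forall>t\<ge>0. P t ` A \<subseteq> A)"

definition attracts ::
    "(real \<Rightarrow> real measure \<Rightarrow> real measure) \<Rightarrow> real measure set \<Rightarrow> real measure set \<Rightarrow> bool" where
  "attracts P K B \<longleftrightarrow> ((\<lambda>t. W2_sets (P t ` B) K) \<longlongrightarrow> 0) at_top"

definition omega_limit ::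
    "(real \<Rightarrow> real measure \<Rightarrow> real measure) \<Rightarrow> real measure set \<Rightarrow> real measure set" where
  "omega_limit P B = (\<Inter>s\<in>{0..}. W2_topology closure_of (\<Union>t\<in>{s..}. P t ` B))"

definition connecting_orbit ::
    "(real \<Rightarrow> real measure \<Rightarrow> real measure) \<Rightarrow> real measure \<Rightarrow> real measure \<Rightarrow>
      (real \<Rightarrow> real measure) \<Rightarrow> bool" where
  "connecting_orbit P \<alpha> \<beta> \<nu> \<longleftrightarrow>
     invariant_measure P \<alpha> \<and> invariant_measure P \<beta> \<and> \<alpha> \<noteq> \<beta> \<and>
     (\<forall>t. \<nu> t \<in> P2) \<and>
     (\<forall>t\<ge>0. \<forall>s. P t (\<nu> s) = \<nu> (t + s)) \<and>
     ((\<lambda>t. W2 (\<nu> t) \<alpha>) \<longlongrightarrow> 0) at_bot \<and>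
     ((\<lambda>t. W2 (\<nu> t) \<beta>) \<longlongrightarrow> 0) at_top"

definition st_increasing :: "(real \<Rightarrow> real measure) \<Rightarrow> bool" where
  "st_increasing \<nu> \<longleftrightarrow> (\<forall>s t. s \<le> t \<longrightarrow> \<nu> s \<le>\<^sub>s\<^sub>t \<nu> t)"

definition st_decreasing :: "(real \<Rightarrow> real measure) \<Rightarrow> bool" where
  "st_decreasing \<nu> \<longleftrightarrow> (\<forall>s t. s \<le> t \<longrightarrow> \<nu> t \<le>\<^sub>s\<^sub>t \<nu> s)"

end

theory Submission
  imports Defs
begin

text \<open>On the real line the comonotone coupling is optimal, so \<^const>\<open>W2\<close> is the \<open>L\<^sup>2\<close> distance of quantile
  functions. Consequently \<^const>\<open>W2\<close> is a metric, and a measure squeezed between two others in stochastic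
  order is at most as far from either of them as they are from each other. Closed order bounded sets
  are compact by Helly's selection theorem and dominated convergence.

  Compactness of \<open>K\<close> makes \<open>\<omega>(B)\<close> negatively invariant, so every \<open>P\<^sub>t \<mu>\<close> inherits from \<open>\<mu>\<close> the property
  of bounding \<open>\<omega>(B)\<close>. Following the connecting orbits, \<open>\<omega>(B)\<close> is squeezed between measures that tend to
  \<open>\<mu>\<^sub>0\<close>, hence \<open>\<omega>(B) \<subseteq> {\<mu>\<^sub>0}\<close>; compactness turns this into attraction.\<close>

section \<open>Optimal transport on the real line\<close>

text \<open>The slice of the triangle at height \<open>t\<close> has length \<open>t - x\<close>,
  and the fundamental theorem of calculus integrates these lengths.\<close>

lemma nn_integral_triangle:
  fixes x y :: real
  shows "(\<integral>\<^sup>+ p. indicator {p. x \<le> fst p \<and> fst p < snd p \<and> snd p < y} p \<partial>(lborel \<Otimes>\<^sub>M lborel)) =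
    (if x \<le> y then ennreal ((y - x)\<^sup>2 / 2) else 0)"
proof -
  have "{p \<in> space (borel \<Otimes>\<^sub>M borel). x \<le> fst p \<and> fst p < snd p \<and> snd p < y} \<in> sets (borel \<Otimes>\<^sub>M borel)"
    by measurable
  then have meas [measurable]: "{p. x \<le> fst p \<and> fst p < snd p \<and> snd p < y} \<in> sets (borel \<Otimes>\<^sub>M borel)"
    by (simp add: space_pair_measure)
  have "(\<integral>\<^sup>+ p. indicator {p. x \<le> fst p \<and> fst p < snd p \<and> snd p < y} p \<partial>(lborel \<Otimes>\<^sub>M lborel)) =
      (\<integral>\<^sup>+ t. \<integral>\<^sup>+ s. indicator {p. x \<le> fst p \<and> fst p < snd p \<and> snd p < y} (s, t) \<partial>lborel \<partial>lborel)"
    by (rule lborel_pair.nn_integral_snd[symmetric]) simp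
  also have "\<dots> = (\<integral>\<^sup>+ t. ennreal (t - x) * indicator {x..y} t \<partial>lborel)"
  \<comment> \<open>The level \<open>t = y\<close> is discarded: its slice is empty, while the
    closed interval required by the FTC rule would still count it.\<close>
  proof (rule nn_integral_cong_AE, use AE_lborel_singleton[of y] in eventually_elim)
    fix t assume "t \<noteq> y"
    have "(\<integral>\<^sup>+ s. indicator {p. x \<le> fst p \<and> fst p < snd p \<and> snd p < y} (s, t) \<partial>lborel) =
        (\<integral>\<^sup>+ s. indicator (if t < y then {x..<t} else {}) s \<partial>lborel)"
      by (rule nn_integral_cong) (auto simp: indicator_def)
    also have "\<dots> = emeasure lborel (if t < y then {x..<t} else {})"
      by (rule nn_integral_indicator) simp
    also have "\<dots> = ennreal (t - x) * indicator {x..y} t"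
      using \<open>t \<noteq> y\<close> by (cases "x \<le> t") auto
    finally show "(\<integral>\<^sup>+ s. indicator {p. x \<le> fst p \<and> fst p < snd p \<and> snd p < y} (s, t) \<partial>lborel) =
        ennreal (t - x) * indicator {x..y} t" .
  qed
  also have "\<dots> = (if x \<le> y then ennreal ((y - x)\<^sup>2 / 2) else 0)"
  proof (cases "x \<le> y")
    case True
    have "(\<integral>\<^sup>+ t. ennreal (t - x) * indicator {x..y} t \<partial>lborel) = (y - x)\<^sup>2 / 2 - (x - x)\<^sup>2 / 2"
      by (rule nn_integral_FTC_Icc[where F = "\<lambda>t. (t - x)\<^sup>2 / 2"])
        (auto simp: True intro!: derivative_eq_intros)
    then show ?thesis using True by simp
  qed simp
  finally show ?thesis .
qed

text \<open>After Tonelli the point \<open>p\<close> is fixed first; what remains of the triangle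
  condition on \<open>w\<close> is the event whose measure appears on the right.\<close>

lemma (in sigma_finite_measure) nn_integral_triangle_cover:
  assumes [measurable]: "X \<in> borel_measurable M" "Y \<in> borel_measurable M"
  shows "(\<integral>\<^sup>+ w. (if X w \<le> Y w then ennreal ((Y w - X w)\<^sup>2 / 2) else 0) \<partial>M) =
    (\<integral>\<^sup>+ p. indicator {p. fst p < snd p} p *
      emeasure M {w \<in> space M. X w \<le> fst p \<and> snd p < Y w} \<partial>(lborel \<Otimes>\<^sub>M lborel))"
proof -
  interpret pair: pair_sigma_finite M "lborel \<Otimes>\<^sub>M lborel :: (real \<times> real) measure"
    by (intro pair_sigma_finite.intro sigma_finite_measure_axioms) (simp add: lborel_prod sigma_finite_lborel)
  have "(\<integral>\<^sup>+ w. (if X w \<le> Y w then ennreal ((Y w - X w)\<^sup>2 / 2) else 0) \<partial>M) =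
    (\<integral>\<^sup>+ w. \<integral>\<^sup>+ p. indicator {p. X w \<le> fst p \<and> fst p < snd p \<and> snd p < Y w} p
      \<partial>(lborel \<Otimes>\<^sub>M lborel) \<partial>M)"
    by (simp add: nn_integral_triangle)
  also have "\<dots> = (\<integral>\<^sup>+ p. \<integral>\<^sup>+ w. indicator {p. X w \<le> fst p \<and> fst p < snd p \<and> snd p < Y w} p
      \<partial>M \<partial>(lborel \<Otimes>\<^sub>M lborel))"
  proof (rule pair.Fubini'[symmetric])
    have "(\<lambda>z. if X (fst z) \<le> fst (snd z) \<and> fst (snd z) < snd (snd z) \<and> snd (snd z) < Y (fst z)
        then 1 else 0 :: ennreal) \<in> borel_measurable (M \<Otimes>\<^sub>M (borel \<Otimes>\<^sub>M borel))"
      by measurable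
    then have "(\<lambda>z. if X (fst z) \<le> fst (snd z) \<and> fst (snd z) < snd (snd z) \<and> snd (snd z) < Y (fst z)
        then 1 else 0 :: ennreal) \<in> borel_measurable (M \<Otimes>\<^sub>M (lborel \<Otimes>\<^sub>M lborel))"
      by (simp cong: measurable_cong_sets)
    then show "(\<lambda>(w, p). indicator {p. X w \<le> fst p \<and> fst p < snd p \<and> snd p < Y w} p :: ennreal)
        \<in> borel_measurable (M \<Otimes>\<^sub>M (lborel \<Otimes>\<^sub>M lborel))"
      by (simp add: split_beta' indicator_def cong: if_cong)
  qed
  also have "\<dots> = (\<integral>\<^sup>+ p. indicator {p. fst p < snd p} p *
      emeasure M {w \<in> space M. X w \<le> fst p \<and> snd p < Y w} \<partial>(lborel \<Otimes>\<^sub>M lborel))"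
  proof (rule nn_integral_cong)
    fix p :: "real \<times> real"
    have "(\<integral>\<^sup>+ w. indicator {p. X w \<le> fst p \<and> fst p < snd p \<and> snd p < Y w} p \<partial>M) =
      (\<integral>\<^sup>+ w. indicator {p. fst p < snd p} p *
         indicator {w \<in> space M. X w \<le> fst p \<and> snd p < Y w} w \<partial>M)"
      by (rule nn_integral_cong) (auto simp: indicator_def)
    then show "(\<integral>\<^sup>+ w. indicator {p. X w \<le> fst p \<and> fst p < snd p \<and> snd p < Y w} p \<partial>M) =
       indicator {p. fst p < snd p} p * emeasure M {w \<in> space M. X w \<le> fst p \<and> snd p < Y w}"
      by (simp add: nn_integral_cmult)
  qed
  finally show ?thesis .
qed

text \<open>Half of \<open>(x - y)\<^sup>2\<close> is the area of the triangle \<open>x \<le> s < t < y\<close> (or its mirror image), so Tonelli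
  expresses a quadratic transport cost through the joint tail events of the coupling.\<close>

lemma (in sigma_finite_measure) nn_integral_power2_diff:
  assumes [measurable]: "X \<in> borel_measurable M" "Y \<in> borel_measurable M"
  shows "(\<integral>\<^sup>+ w. ennreal ((X w - Y w)\<^sup>2) \<partial>M) =
    2 * (\<integral>\<^sup>+ p. indicator {p. fst p < snd p} p *
      (emeasure M {w \<in> space M. X w \<le> fst p \<and> snd p < Y w} +
       emeasure M {w \<in> space M. Y w \<le> fst p \<and> snd p < X w}) \<partial>(lborel \<Otimes>\<^sub>M lborel))"
proof -
  have "(\<integral>\<^sup>+ w. ennreal ((X w - Y w)\<^sup>2) \<partial>M) =
    (\<integral>\<^sup>+ w. 2 * ((if X w \<le> Y w then ennreal ((Y w - X w)\<^sup>2 / 2) else 0) +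
      (if Y w \<le> X w then ennreal ((X w - Y w)\<^sup>2 / 2) else 0)) \<partial>M)"
  proof (rule nn_integral_cong)
    fix w
    have "2 * ennreal (a / 2) = ennreal a" if "a \<ge> 0" for a
      using that ennreal_mult[of 2 "a / 2"] by (simp add: ennreal_numeral)
    then show "ennreal ((X w - Y w)\<^sup>2) = 2 * ((if X w \<le> Y w then ennreal ((Y w - X w)\<^sup>2 / 2) else 0) +
      (if Y w \<le> X w then ennreal ((X w - Y w)\<^sup>2 / 2) else 0))"
      by (auto simp: power2_commute)
  qed
  also have "\<dots> = 2 * ((\<integral>\<^sup>+ w. (if X w \<le> Y w then ennreal ((Y w - X w)\<^sup>2 / 2) else 0) \<partial>M) +
      (\<integral>\<^sup>+ w. (if Y w \<le> X w then ennreal ((X w - Y w)\<^sup>2 / 2) else 0) \<partial>M))"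
    by (simp add: nn_integral_cmult nn_integral_add)
  also have "\<dots> = 2 * (\<integral>\<^sup>+ p. indicator {p. fst p < snd p} p *
      (emeasure M {w \<in> space M. X w \<le> fst p \<and> snd p < Y w} +
       emeasure M {w \<in> space M. Y w \<le> fst p \<and> snd p < X w}) \<partial>(lborel \<Otimes>\<^sub>M lborel))"
    unfolding nn_integral_triangle_cover[OF assms] nn_integral_triangle_cover[OF assms(2,1)] distrib_left
    by (subst nn_integral_add) (simp_all)
  finally show ?thesis .
qed

text \<open>Minkowski's inequality in squared form, so that no roots of extended numbers occur.
  Cauchy-Schwarz bounds the cross term by \<open>a * b\<close>.\<close>

lemma nn_integral_power2_add_le:
  fixes f g :: "'a \<Rightarrow> real" and a b :: real
  assumes [measurable]: "f \<in> borel_measurable M" "g \<in> borel_measurable M"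
    and f: "(\<integral>\<^sup>+ x. ennreal ((f x)\<^sup>2) \<partial>M) \<le> ennreal (a\<^sup>2)" and "0 \<le> a"
    and g: "(\<integral>\<^sup>+ x. ennreal ((g x)\<^sup>2) \<partial>M) \<le> ennreal (b\<^sup>2)" and "0 \<le> b"
  shows "(\<integral>\<^sup>+ x. ennreal ((f x + g x)\<^sup>2) \<partial>M) \<le> ennreal ((a + b)\<^sup>2)"
proof -
  define C where "C = (\<integral>\<^sup>+ x. ennreal \<bar>f x\<bar> * ennreal \<bar>g x\<bar> \<partial>M)"
  have "C\<^sup>2 \<le> (\<integral>\<^sup>+ x. ennreal \<bar>f x\<bar> ^ 2 \<partial>M) * (\<integral>\<^sup>+ x. ennreal \<bar>g x\<bar> ^ 2 \<partial>M)"
    unfolding C_def by (rule Cauchy_Schwarz_nn_integral) measurable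
  also have "\<dots> \<le> ennreal (a\<^sup>2) * ennreal (b\<^sup>2)"
    using f g by (intro mult_mono) (auto simp: ennreal_power)
  finally have C2: "C\<^sup>2 \<le> ennreal ((a * b)\<^sup>2)"
    by (simp add: ennreal_mult'[symmetric] power_mult_distrib)
  have C: "C \<le> ennreal (a * b)"
  proof (cases C)
    case (real c)
    then have "c\<^sup>2 \<le> (a * b)\<^sup>2" using C2 by (simp add: ennreal_power)
    then have "c \<le> a * b" by (rule power2_le_imp_le) (use \<open>0 \<le> a\<close> \<open>0 \<le> b\<close> in simp)
    then show ?thesis using real by (simp add: ennreal_leI)
  qed (use C2 in \<open>simp add: power2_eq_square top_unique\<close>)
  have "(\<integral>\<^sup>+ x. ennreal ((f x + g x)\<^sup>2) \<partial>M) \<le>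
    (\<integral>\<^sup>+ x. ennreal ((f x)\<^sup>2) + 2 * (ennreal \<bar>f x\<bar> * ennreal \<bar>g x\<bar>) + ennreal ((g x)\<^sup>2) \<partial>M)"
  proof (rule nn_integral_mono)
    fix x
    have "(f x + g x)\<^sup>2 \<le> (f x)\<^sup>2 + 2 * (\<bar>f x\<bar> * \<bar>g x\<bar>) + (g x)\<^sup>2"
      using abs_ge_self[of "f x * g x"] by (simp add: power2_sum abs_mult)
    then have "ennreal ((f x + g x)\<^sup>2) \<le> ennreal ((f x)\<^sup>2 + 2 * (\<bar>f x\<bar> * \<bar>g x\<bar>) + (g x)\<^sup>2)"
      by (rule ennreal_leI)
    then show "ennreal ((f x + g x)\<^sup>2) \<le>
        ennreal ((f x)\<^sup>2) + 2 * (ennreal \<bar>f x\<bar> * ennreal \<bar>g x\<bar>) + ennreal ((g x)\<^sup>2)"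
      by (simp add: ennreal_plus ennreal_mult)
  qed
  also have "\<dots> = (\<integral>\<^sup>+ x. ennreal ((f x)\<^sup>2) \<partial>M) + 2 * C + (\<integral>\<^sup>+ x. ennreal ((g x)\<^sup>2) \<partial>M)"
    unfolding C_def by (simp add: nn_integral_add nn_integral_cmult)
  also have "\<dots> \<le> ennreal (a\<^sup>2) + 2 * ennreal (a * b) + ennreal (b\<^sup>2)"
    using f g C by (intro add_mono mult_left_mono) auto
  also have "\<dots> = ennreal ((a + b)\<^sup>2)"
    using \<open>0 \<le> a\<close> \<open>0 \<le> b\<close>
    by (simp add: power2_sum ennreal_plus ennreal_mult ac_simps)
  finally show ?thesis .
qed

text \<open>The generalized inverse of the distribution function. It is evaluated only at
  \<open>0 < u < 1\<close>, where the set is nonempty and bounded below.\<close>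

definition quantile :: "real measure \<Rightarrow> real \<Rightarrow> real" where
  "quantile \<mu> u = Inf {x. u \<le> cdf \<mu> x}"

abbreviation unit_interval :: "real measure" where
  "unit_interval \<equiv> restrict_space lborel {0<..<1}"

interpretation unit_interval: prob_space unit_interval
  by (auto simp: space_restrict_space emeasure_restrict_space intro!: prob_spaceI)

context
  fixes \<mu> :: "real measure"
  assumes \<mu>: "real_distribution \<mu>"
begin

interpretation cdf_distribution \<mu>
  using \<mu> by (rule cdf_distribution.intro)

text \<open>Right continuity of \<open>cdf \<mu>\<close> makes the infimum attained, which yields
  this Galois connection.\<close>

lemma quantile_le_iff: "0 < u \<Longrightarrow> u < 1 \<Longrightarrow> quantile \<mu> u \<le> x \<longleftrightarrow> u \<le> cdf \<mu> x"
  unfolding quantile_def using pseudoinverse by blast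

lemma measurable_quantile: "quantile \<mu> \<in> borel_measurable unit_interval"
  using measurable_CI unfolding quantile_def[abs_def]
  by (simp cong: measurable_cong_sets add: sets_restrict_space)

lemma distr_quantile: "distr unit_interval borel (quantile \<mu>) = \<mu>"
  using distr_I_eq_M unfolding quantile_def[abs_def] .

lemma measurable_cdf: "cdf \<mu> \<in> borel_measurable borel"
  by (rule measurable_C)

end

section \<open>Transport cost through quantile functions and through distribution functions\<close>

definition quantile_cost :: "real measure \<Rightarrow> real measure \<Rightarrow> ennreal" where
  "quantile_cost \<mu> \<nu> = (\<integral>\<^sup>+ u. ennreal ((quantile \<mu> u - quantile \<nu> u)\<^sup>2) \<partial>unit_interval)"

text \<open>This is the tail formula of \<open>nn_integral_power2_diff\<close> with the probability
  of \<open>X \<le> s\<close>, \<open>t < Y\<close> replaced by its smallest possible value given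
  the marginals. Since \<open>ennreal\<close> sends negative numbers to zero, each summand is a
  positive part.\<close>

definition cdf_cost :: "real measure \<Rightarrow> real measure \<Rightarrow> ennreal" where
  "cdf_cost \<mu> \<nu> = 2 * (\<integral>\<^sup>+ p. indicator {p. fst p < snd p} p *
     (ennreal (cdf \<mu> (fst p) - cdf \<nu> (snd p)) + ennreal (cdf \<nu> (fst p) - cdf \<mu> (snd p)))
       \<partial>(lborel \<Otimes>\<^sub>M lborel))"

text \<open>The event \<open>X \<le> s\<close> is covered by \<open>X \<le> s \<and> t < Y\<close>
  and \<open>Y \<le> t\<close>. Subadditivity therefore bounds the joint tail from below by marginal
  data alone, whatever the coupling.\<close>

lemma cdf_cost_le_coupling:
  assumes "\<pi> \<in> couplings \<mu> \<nu>"
  shows "cdf_cost \<mu> \<nu> \<le> (\<integral>\<^sup>+ (x, y). ennreal ((x - y)\<^sup>2) \<partial>\<pi>)"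
proof -
  interpret \<pi>: prob_space \<pi> using assms by (simp add: couplings_def)
  have sets [measurable_cong]: "sets \<pi> = sets (borel \<Otimes>\<^sub>M borel)"
    and \<mu>: "\<mu> = distr \<pi> borel fst" and \<nu>: "\<nu> = distr \<pi> borel snd"
    using assms by (auto simp: couplings_def)
  have aux: "ennreal (cdf (distr \<pi> borel X) s - cdf (distr \<pi> borel Y) t) \<le>
      emeasure \<pi> {w \<in> space \<pi>. X w \<le> s \<and> t < Y w}"
    if [measurable]: "X \<in> borel_measurable \<pi>" "Y \<in> borel_measurable \<pi>" for X Y s t
  proof -
    have "cdf (distr \<pi> borel X) s = measure \<pi> {w \<in> space \<pi>. X w \<le> s}"
      by (auto simp: cdf_def measure_distr intro!: arg_cong[where f = "measure \<pi>"])
    also have "\<dots> \<le> measure \<pi> ({w \<in> space \<pi>. X w \<le> s \<and> t < Y w} \<union> {w \<in> space \<pi>. Y w \<le> t})"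
      by (rule \<pi>.finite_measure_mono) auto
    also have "\<dots> \<le> measure \<pi> {w \<in> space \<pi>. X w \<le> s \<and> t < Y w} + measure \<pi> {w \<in> space \<pi>. Y w \<le> t}"
      by (rule measure_Un_le) auto
    also have "measure \<pi> {w \<in> space \<pi>. Y w \<le> t} = cdf (distr \<pi> borel Y) t"
      by (auto simp: cdf_def measure_distr intro!: arg_cong[where f = "measure \<pi>"])
    finally show ?thesis
      by (simp add: \<pi>.emeasure_eq_measure ennreal_leI)
  qed
  have "cdf_cost \<mu> \<nu> \<le> 2 * (\<integral>\<^sup>+ p. indicator {p. fst p < snd p} p *
      (emeasure \<pi> {w \<in> space \<pi>. fst w \<le> fst p \<and> snd p < snd w} +
       emeasure \<pi> {w \<in> space \<pi>. snd w \<le> fst p \<and> snd p < fst w}) \<partial>(lborel \<Otimes>\<^sub>M lborel))"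
    unfolding cdf_cost_def
    by (intro mult_left_mono nn_integral_mono add_mono) (simp_all add: \<mu> \<nu> aux)
  also have "\<dots> = (\<integral>\<^sup>+ w. ennreal ((fst w - snd w)\<^sup>2) \<partial>\<pi>)"
    by (rule \<pi>.nn_integral_power2_diff[symmetric]) measurable
  finally show ?thesis
    by (simp add: split_beta')
qed

context
  fixes \<mu> \<nu> :: "real measure"
  assumes \<mu>: "real_distribution \<mu>" and \<nu>: "real_distribution \<nu>"
begin

lemmas [measurable] = measurable_quantile[OF \<mu>] measurable_quantile[OF \<nu>]

text \<open>The set of levels at which the quantile functions separate \<open>s\<close> from \<open>t\<close> is the interval between
  \<open>cdf \<nu> t\<close> and \<open>cdf \<mu> s\<close>; hence the comonotone coupling attains the lower bound \<^const>\<open>cdf_cost\<close>.\<close>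

lemma quantile_cost_le_cdf_cost: "quantile_cost \<mu> \<nu> \<le> cdf_cost \<mu> \<nu>"
proof -
  have aux: "emeasure unit_interval {u \<in> space unit_interval. quantile \<alpha> u \<le> s \<and> t < quantile \<beta> u}
      \<le> ennreal (cdf \<alpha> s - cdf \<beta> t)"
    if "real_distribution \<alpha>" "real_distribution \<beta>" for \<alpha> \<beta> s t
  proof -
    have "{u \<in> space unit_interval. quantile \<alpha> u \<le> s \<and> t < quantile \<beta> u} =
        {0<..<1} \<inter> {cdf \<beta> t<..cdf \<alpha> s}" (is "?A = ?B")
    proof (rule set_eqI)
      fix u
      show "u \<in> ?A \<longleftrightarrow> u \<in> ?B"
        using quantile_le_iff[OF that(1), of u s] quantile_le_iff[OF that(2), of u t]
        by (auto simp: space_restrict_space)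
    qed
    then have "emeasure unit_interval ?A = emeasure unit_interval ?B"
      by (rule arg_cong)
    also have "\<dots> = emeasure lborel ?B"
      by (rule emeasure_restrict_space) auto
    also have "\<dots> \<le> emeasure lborel {cdf \<beta> t<..cdf \<alpha> s}"
      by (rule emeasure_mono) auto
    also have "\<dots> \<le> ennreal (cdf \<alpha> s - cdf \<beta> t)"
      by (cases "cdf \<beta> t \<le> cdf \<alpha> s") auto
    finally show ?thesis .
  qed
  have "quantile_cost \<mu> \<nu> = 2 * (\<integral>\<^sup>+ p. indicator {p. fst p < snd p} p *
      (emeasure unit_interval {u \<in> space unit_interval. quantile \<mu> u \<le> fst p \<and> snd p < quantile \<nu> u} +
       emeasure unit_interval {u \<in> space unit_interval. quantile \<nu> u \<le> fst p \<and> snd p < quantile \<mu> u})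
      \<partial>(lborel \<Otimes>\<^sub>M lborel))"
    unfolding quantile_cost_def by (rule unit_interval.nn_integral_power2_diff) measurable
  also have "\<dots> \<le> cdf_cost \<mu> \<nu>"
    unfolding cdf_cost_def
    by (intro mult_left_mono nn_integral_mono add_mono aux \<mu> \<nu>) simp_all
  finally show ?thesis .
qed

text \<open>Feeding one uniform variable into both quantile functions produces the right marginals,
  because each quantile function pushes the uniform law to its measure.\<close>

lemma comonotone_coupling:
  defines "\<pi> \<equiv> distr unit_interval (borel \<Otimes>\<^sub>M borel) (\<lambda>u. (quantile \<mu> u, quantile \<nu> u))"
  shows "\<pi> \<in> couplings \<mu> \<nu>"
    and "(\<integral>\<^sup>+ (x, y). ennreal ((x - y)\<^sup>2) \<partial>\<pi>) = quantile_cost \<mu> \<nu>"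
proof -
  show "\<pi> \<in> couplings \<mu> \<nu>"
    unfolding couplings_def \<pi>_def
    by (auto simp: distr_distr comp_def distr_quantile[OF \<mu>] distr_quantile[OF \<nu>]
        intro!: unit_interval.prob_space_distr)
  show "(\<integral>\<^sup>+ (x, y). ennreal ((x - y)\<^sup>2) \<partial>\<pi>) = quantile_cost \<mu> \<nu>"
    unfolding \<pi>_def quantile_cost_def by (subst nn_integral_distr) (simp_all add: split_beta')
qed

lemma INF_couplings_eq_quantile_cost:
  "(INF \<pi>\<in>couplings \<mu> \<nu>. \<integral>\<^sup>+ (x, y). ennreal ((x - y)\<^sup>2) \<partial>\<pi>) = quantile_cost \<mu> \<nu>"
proof (rule antisym)
  show "(INF \<pi>\<in>couplings \<mu> \<nu>. \<integral>\<^sup>+ (x, y). ennreal ((x - y)\<^sup>2) \<partial>\<pi>) \<le> quantile_cost \<mu> \<nu>"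
    by (rule INF_lower2[OF comonotone_coupling(1)]) (simp add: comonotone_coupling(2))
  show "quantile_cost \<mu> \<nu> \<le> (INF \<pi>\<in>couplings \<mu> \<nu>. \<integral>\<^sup>+ (x, y). ennreal ((x - y)\<^sup>2) \<partial>\<pi>)"
    by (rule INF_greatest) (rule order_trans[OF quantile_cost_le_cdf_cost cdf_cost_le_coupling])
qed

text \<open>The lower bound for all couplings, applied to the comonotone one, closes the circle of
  inequalities. The cdf form suits weak convergence, which speaks about pointwise limits of
  distribution functions.\<close>

lemma quantile_cost_eq_cdf_cost: "quantile_cost \<mu> \<nu> = cdf_cost \<mu> \<nu>"
  by (rule antisym[OF quantile_cost_le_cdf_cost])
    (use cdf_cost_le_coupling[OF comonotone_coupling(1)] in \<open>simp add: comonotone_coupling(2)\<close>)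

lemma W2_eq_quantile_cost: "W2 \<mu> \<nu> = sqrt (enn2real (quantile_cost \<mu> \<nu>))"
  unfolding W2_def INF_couplings_eq_quantile_cost ..

end

section \<open>The metric space\<close>

lemma P2_real_distribution: "\<mu> \<in> P2 \<Longrightarrow> real_distribution \<mu>"
  by (simp add: P2_def real_distribution_def real_distribution_axioms_def)

lemma nn_integral_quantile_power2:
  assumes "real_distribution \<mu>"
  shows "(\<integral>\<^sup>+ u. ennreal ((quantile \<mu> u)\<^sup>2) \<partial>unit_interval) = (\<integral>\<^sup>+ x. ennreal (x\<^sup>2) \<partial>\<mu>)"
proof -
  have "(\<integral>\<^sup>+ x. ennreal (x\<^sup>2) \<partial>\<mu>) = (\<integral>\<^sup>+ x. ennreal (x\<^sup>2) \<partial>distr unit_interval borel (quantile \<mu>))"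
    by (simp add: distr_quantile[OF assms])
  also have "\<dots> = (\<integral>\<^sup>+ u. ennreal ((quantile \<mu> u)\<^sup>2) \<partial>unit_interval)"
    by (rule nn_integral_distr) (use measurable_quantile[OF assms] in simp_all)
  finally show ?thesis ..
qed

text \<open>A change of variables identifies the second moment with the squared \<open>L^2\<close>
  norm of the quantile function. This is how a weak limit is later recognized as an element of
  \<open>P2\<close>.\<close>

lemma P2_iff_quantile:
  "\<mu> \<in> P2 \<longleftrightarrow> real_distribution \<mu> \<and>
    (\<integral>\<^sup>+ u. ennreal ((quantile \<mu> u)\<^sup>2) \<partial>unit_interval) < \<infinity>"
proof (cases "real_distribution \<mu>")
  case True
  then interpret real_distribution \<mu> .
  have "integrable \<mu> (\<lambda>x. x\<^sup>2) \<longleftrightarrow> (\<integral>\<^sup>+ x. ennreal (x\<^sup>2) \<partial>\<mu>) < \<infinity>"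
    by (subst integrable_iff_bounded) simp
  then show ?thesis
    unfolding nn_integral_quantile_power2[OF True] P2_def using True prob_space_axioms by simp
qed (use P2_real_distribution in blast)

lemma nn_integral_power2_diff_less_top:
  fixes f g :: "'a \<Rightarrow> real"
  assumes [measurable]: "f \<in> borel_measurable M" "g \<in> borel_measurable M"
    and "(\<integral>\<^sup>+ x. ennreal ((f x)\<^sup>2) \<partial>M) < \<infinity>" "(\<integral>\<^sup>+ x. ennreal ((g x)\<^sup>2) \<partial>M) < \<infinity>"
  shows "(\<integral>\<^sup>+ x. ennreal ((f x - g x)\<^sup>2) \<partial>M) < \<infinity>"
proof -
  have "(\<integral>\<^sup>+ x. ennreal ((f x - g x)\<^sup>2) \<partial>M) \<le>
      (\<integral>\<^sup>+ x. 2 * ennreal ((f x)\<^sup>2) + 2 * ennreal ((g x)\<^sup>2) \<partial>M)"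
  proof (rule nn_integral_mono)
    fix x
    have "(f x - g x)\<^sup>2 \<le> 2 * (f x)\<^sup>2 + 2 * (g x)\<^sup>2"
      using zero_le_power2[of "f x + g x"] by (simp add: power2_sum power2_diff)
    then have "ennreal ((f x - g x)\<^sup>2) \<le> ennreal (2 * (f x)\<^sup>2 + 2 * (g x)\<^sup>2)"
      by (rule ennreal_leI)
    then show "ennreal ((f x - g x)\<^sup>2) \<le> 2 * ennreal ((f x)\<^sup>2) + 2 * ennreal ((g x)\<^sup>2)"
      by (simp add: ennreal_mult)
  qed
  also have "\<dots> < \<infinity>"
    using assms(3,4) by (simp add: nn_integral_add nn_integral_cmult ennreal_mult_less_top)
  finally show ?thesis .
qed

lemma quantile_cost_less_top:
  assumes "\<mu> \<in> P2" "\<nu> \<in> P2"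
  shows "quantile_cost \<mu> \<nu> < \<infinity>"
  unfolding quantile_cost_def using assms
  by (intro nn_integral_power2_diff_less_top)
    (auto simp: P2_iff_quantile intro: measurable_quantile)

text \<open>On \<open>P2\<close> the cost is finite, so \<open>enn2real\<close> and the square root
  can be undone and metric estimates can be carried out on integrals.\<close>

lemma ennreal_W2_power2:
  assumes "\<mu> \<in> P2" "\<nu> \<in> P2"
  shows "ennreal ((W2 \<mu> \<nu>)\<^sup>2) = quantile_cost \<mu> \<nu>"
  using assms quantile_cost_less_top[OF assms]
  by (simp add: W2_eq_quantile_cost P2_real_distribution)

lemma W2_nonneg: "0 \<le> W2 \<mu> \<nu>"
  by (simp add: W2_def)

lemma W2_le_iff:
  assumes "\<mu> \<in> P2" "\<nu> \<in> P2" "0 \<le> r"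
  shows "W2 \<mu> \<nu> \<le> r \<longleftrightarrow> quantile_cost \<mu> \<nu> \<le> ennreal (r\<^sup>2)"
  using assms W2_nonneg[of \<mu> \<nu>] by (simp flip: ennreal_W2_power2 add: power2_le_iff_abs_le)

lemma Metric_space_W2: "Metric_space P2 W2"
proof
  show "0 \<le> W2 \<mu> \<nu>" for \<mu> \<nu>
    by (rule W2_nonneg)
next
  \<comment> \<open>The locale asks for symmetry on arbitrary measures, where quantile functions are not available.\<close>
  fix \<mu> \<nu>
  have "(INF \<pi>\<in>couplings \<mu> \<nu>. \<integral>\<^sup>+ (x, y). ennreal ((x - y)\<^sup>2) \<partial>\<pi>) \<ge>
      (INF \<pi>\<in>couplings \<nu> \<mu>. \<integral>\<^sup>+ (x, y). ennreal ((x - y)\<^sup>2) \<partial>\<pi>)" for \<mu> \<nu>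
  proof (rule INF_greatest)
    fix \<pi> assume \<pi>: "\<pi> \<in> couplings \<mu> \<nu>"
    then interpret prob_space \<pi> by (simp add: couplings_def)
    have sets [measurable_cong]: "sets \<pi> = sets (borel \<Otimes>\<^sub>M borel)"
      and "distr \<pi> borel fst = \<mu>" "distr \<pi> borel snd = \<nu>"
      using \<pi> by (auto simp: couplings_def)
    have [measurable]: "(\<lambda>(x, y). (y, x)) \<in> \<pi> \<rightarrow>\<^sub>M (borel \<Otimes>\<^sub>M borel :: (real \<times> real) measure)"
      by measurable
    \<comment> \<open>Swapping the coordinates exchanges the marginals and preserves the
      cost.\<close>
    define \<pi>' where "\<pi>' = distr \<pi> (borel \<Otimes>\<^sub>M borel :: (real \<times> real) measure) (\<lambda>(x, y). (y, x))"
    have "distr \<pi>' borel fst = distr \<pi> borel snd" "distr \<pi>' borel snd = distr \<pi> borel fst"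
      unfolding \<pi>'_def by (simp_all add: distr_distr comp_def split_beta')
    then have "\<pi>' \<in> couplings \<nu> \<mu>"
      using \<open>distr \<pi> borel fst = \<mu>\<close> \<open>distr \<pi> borel snd = \<nu>\<close>
      by (simp add: couplings_def \<pi>'_def prob_space_distr)
    moreover have "(\<integral>\<^sup>+ (x, y). ennreal ((x - y)\<^sup>2) \<partial>\<pi>') = (\<integral>\<^sup>+ (x, y). ennreal ((x - y)\<^sup>2) \<partial>\<pi>)"
      unfolding \<pi>'_def by (subst nn_integral_distr) (auto simp: split_beta' power2_commute)
    ultimately show "(INF \<pi>\<in>couplings \<nu> \<mu>. \<integral>\<^sup>+ (x, y). ennreal ((x - y)\<^sup>2) \<partial>\<pi>) \<le>
        (\<integral>\<^sup>+ (x, y). ennreal ((x - y)\<^sup>2) \<partial>\<pi>)"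
      by (metis INF_lower)
  qed
  then show "W2 \<mu> \<nu> = W2 \<nu> \<mu>"
    unfolding W2_def by (metis antisym)
next
  fix \<mu> \<nu> assume "\<mu> \<in> P2" "\<nu> \<in> P2"
  then have \<mu>: "real_distribution \<mu>" and \<nu>: "real_distribution \<nu>"
    by (simp_all add: P2_real_distribution)
  note [measurable] = measurable_quantile[OF \<mu>] measurable_quantile[OF \<nu>]
  show "W2 \<mu> \<nu> = 0 \<longleftrightarrow> \<mu> = \<nu>"
  proof
    assume "W2 \<mu> \<nu> = 0"
    then have "quantile_cost \<mu> \<nu> = 0"
      using ennreal_W2_power2[OF \<open>\<mu> \<in> P2\<close> \<open>\<nu> \<in> P2\<close>] by simp
    \<comment> \<open>Quantile functions that agree almost everywhere push the uniform law to the
      same measure.\<close>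
    then have "AE u in unit_interval. quantile \<mu> u = quantile \<nu> u"
      unfolding quantile_cost_def by (subst (asm) nn_integral_0_iff_AE) auto
    then have "distr unit_interval borel (quantile \<mu>) = distr unit_interval borel (quantile \<nu>)"
      by (intro distr_cong_AE) auto
    then show "\<mu> = \<nu>"
      by (simp add: distr_quantile \<mu> \<nu>)
  next
    assume "\<mu> = \<nu>"
    then show "W2 \<mu> \<nu> = 0"
      by (simp add: W2_eq_quantile_cost \<nu> quantile_cost_def)
  qed
next
  fix \<mu> \<nu> \<rho> assume P2: "\<mu> \<in> P2" "\<nu> \<in> P2" "\<rho> \<in> P2"
  note [measurable] = P2[THEN P2_real_distribution, THEN measurable_quantile]
  \<comment> \<open>The triangle inequality is Minkowski's inequality for the telescoping sum of
    quantile differences.\<close>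
  have "(\<integral>\<^sup>+ u. ennreal (((quantile \<mu> u - quantile \<nu> u) + (quantile \<nu> u - quantile \<rho> u))\<^sup>2)
      \<partial>unit_interval) \<le> ennreal ((W2 \<mu> \<nu> + W2 \<nu> \<rho>)\<^sup>2)"
  proof (rule nn_integral_power2_add_le)
    show "(\<integral>\<^sup>+ u. ennreal ((quantile \<mu> u - quantile \<nu> u)\<^sup>2) \<partial>unit_interval) \<le> ennreal ((W2 \<mu> \<nu>)\<^sup>2)"
      "(\<integral>\<^sup>+ u. ennreal ((quantile \<nu> u - quantile \<rho> u)\<^sup>2) \<partial>unit_interval) \<le> ennreal ((W2 \<nu> \<rho>)\<^sup>2)"
      using P2 by (simp_all add: ennreal_W2_power2 quantile_cost_def)
  qed (simp_all add: W2_nonneg)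
  then show "W2 \<mu> \<rho> \<le> W2 \<mu> \<nu> + W2 \<nu> \<rho>"
    using P2 by (simp add: W2_le_iff W2_nonneg quantile_cost_def)
qed

interpretation W2: Metric_space P2 W2
  by (rule Metric_space_W2)

lemma W2_monotone:
  assumes P2: "\<mu> \<in> P2" "\<nu> \<in> P2" "\<mu>' \<in> P2" "\<nu>' \<in> P2"
    and le: "\<And>u. u \<in> {0<..<1} \<Longrightarrow> \<bar>quantile \<mu> u - quantile \<nu> u\<bar> \<le> \<bar>quantile \<mu>' u - quantile \<nu>' u\<bar>"
  shows "W2 \<mu> \<nu> \<le> W2 \<mu>' \<nu>'"
proof -
  have "quantile_cost \<mu> \<nu> \<le> quantile_cost \<mu>' \<nu>'"
    unfolding quantile_cost_def
    by (rule nn_integral_mono) (use le in \<open>simp add: space_restrict_space abs_le_square_iff ennreal_leI\<close>)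
  then show ?thesis
    using P2 by (simp add: W2_le_iff W2_nonneg ennreal_W2_power2)
qed

section \<open>Stochastic order through distribution and quantile functions\<close>

lemma st_le_imp_cdf_le:
  assumes "\<mu> \<le>\<^sub>s\<^sub>t \<nu>" "real_distribution \<mu>" "real_distribution \<nu>"
  shows "cdf \<nu> x \<le> cdf \<mu> x"
proof -
  interpret \<mu>: real_distribution \<mu> by fact
  interpret \<nu>: real_distribution \<nu> by fact
  \<comment> \<open>The indicator of an upper ray is an admissible test function; passing to
    complements reverses the inequality.\<close>
  have "mono (indicator {x<..} :: real \<Rightarrow> real)" "bounded (range (indicator {x<..} :: real \<Rightarrow> real))"
    by (auto simp: mono_def indicator_def intro!: boundedI[of _ 1])
  then have "integral\<^sup>L \<mu> (indicator {x<..} :: real \<Rightarrow> real) \<le> integral\<^sup>L \<nu> (indicator {x<..})"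
    by (rule assms(1)[unfolded st_le_def, rule_format, OF conjI])
  then have "measure \<mu> {x<..} \<le> measure \<nu> {x<..}"
    by simp
  moreover have "{x<..} = UNIV - {..x}" by auto
  ultimately show ?thesis
    using \<mu>.prob_compl[of "{..x}"] \<nu>.prob_compl[of "{..x}"] by (simp add: cdf_def)
qed

lemma st_le_imp_quantile_le:
  assumes "\<mu> \<le>\<^sub>s\<^sub>t \<nu>" "real_distribution \<mu>" "real_distribution \<nu>" "u \<in> {0<..<1}"
  shows "quantile \<mu> u \<le> quantile \<nu> u"
proof -
  have "u \<le> cdf \<nu> (quantile \<nu> u)"
    using quantile_le_iff[OF assms(3), of u "quantile \<nu> u"] assms(4) by simp
  also have "\<dots> \<le> cdf \<mu> (quantile \<nu> u)"
    using assms(1-3) by (rule st_le_imp_cdf_le)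
  finally show ?thesis
    using quantile_le_iff[OF assms(2), of u "quantile \<nu> u"] assms(4) by simp
qed

text \<open>The three quantile functions are ordered pointwise, so the distance to the lowest one
  can only grow from \<open>\<rho>\<close> to \<open>\<nu>\<close>.\<close>

lemma W2_le_of_between:
  assumes P2: "\<mu> \<in> P2" "\<nu> \<in> P2" "\<rho> \<in> P2" and "\<mu> \<le>\<^sub>s\<^sub>t \<rho>" "\<rho> \<le>\<^sub>s\<^sub>t \<nu>"
  shows "W2 \<rho> \<mu> \<le> W2 \<nu> \<mu>"
proof (rule W2_monotone)
  fix u :: real assume "u \<in> {0<..<1}"
  then have "quantile \<mu> u \<le> quantile \<rho> u" "quantile \<rho> u \<le> quantile \<nu> u"
    using assms by (auto intro!: st_le_imp_quantile_le P2_real_distribution)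
  then show "\<bar>quantile \<rho> u - quantile \<mu> u\<bar> \<le> \<bar>quantile \<nu> u - quantile \<mu> u\<bar>"
    by simp
qed (use P2 in auto)

section \<open>Order bounded sets\<close>

text \<open>A countable set is Lebesgue null, and Fubini lifts this to either coordinate. It serves
  to ignore the atoms of a weak limit in the double integral.\<close>

lemma AE_lborel_pair_countable:
  fixes C :: "real set"
  assumes "countable C"
  shows "AE p in lborel \<Otimes>\<^sub>M lborel. fst p \<notin> C \<and> snd p \<notin> C"
proof -
  have C: "AE x in lborel. x \<notin> C"
    using assms countable_imp_null_set_lborel AE_not_in by blast
  have [measurable]: "C \<in> sets borel"
    using assms by (rule sets.countable[rotated]) simp
  have "AE p in lborel \<Otimes>\<^sub>M lborel. fst p \<notin> C"
  proof (rule lborel_pair.AE_pair_measure)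
    show "{p \<in> space (lborel \<Otimes>\<^sub>M lborel). fst p \<notin> C} \<in> sets (lborel \<Otimes>\<^sub>M lborel)"
      by measurable
    show "AE x in lborel. AE y in lborel. fst (x, y) \<notin> C"
      using C by eventually_elim simp
  qed
  moreover have "AE p in lborel \<Otimes>\<^sub>M lborel. snd p \<notin> C"
  proof (rule lborel_pair.AE_pair_measure)
    show "{p \<in> space (lborel \<Otimes>\<^sub>M lborel). snd p \<notin> C} \<in> sets (lborel \<Otimes>\<^sub>M lborel)"
      by measurable
    show "AE x in lborel. AE y in lborel. snd (x, y) \<notin> C"
      using C by simp
  qed
  ultimately show ?thesis
    by simp
qed

text \<open>Helly's theorem yields a weak limit. The integrand of \<^const>\<open>cdf_cost\<close> converges to \<open>0\<close> off the
  atoms of the limit, because a distribution function is monotone, and it is dominated by twice the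
  integrand belonging to the two order bounds.\<close>

lemma order_bounded_sequentially_compact:
  assumes \<sigma>: "\<And>n. \<sigma> n \<in> P2" and \<alpha>: "\<alpha> \<in> P2" "\<And>n. \<alpha> \<le>\<^sub>s\<^sub>t \<sigma> n" and \<beta>: "\<beta> \<in> P2" "\<And>n. \<sigma> n \<le>\<^sub>s\<^sub>t \<beta>"
  shows "\<exists>r \<rho>. strict_mono (r :: nat \<Rightarrow> nat) \<and> \<rho> \<in> P2 \<and> (\<lambda>n. W2 (\<sigma> (r n)) \<rho>) \<longlonglongrightarrow> 0"
proof -
  interpret \<alpha>: real_distribution \<alpha> using \<alpha> P2_real_distribution by blast
  interpret \<beta>: real_distribution \<beta> using \<beta> P2_real_distribution by blast
  interpret \<sigma>: real_distribution "\<sigma> n" for n using \<sigma> P2_real_distribution by blast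
  have le\<alpha>: "cdf (\<sigma> n) x \<le> cdf \<alpha> x" and le\<beta>: "cdf \<beta> x \<le> cdf (\<sigma> n) x" for n x
    using \<alpha> \<beta> \<sigma> by (auto intro!: st_le_imp_cdf_le P2_real_distribution)
  \<comment> \<open>The lower bound \<open>\<alpha>\<close> controls the mass near minus infinity
    and the upper bound \<open>\<beta>\<close> the mass near plus infinity, uniformly in
    \<open>n\<close>.\<close>
  have "tight \<sigma>"
    unfolding tight_def
  proof (intro conjI allI impI)
    fix \<epsilon> :: real assume "\<epsilon> > 0"
    have "eventually (\<lambda>x. cdf \<alpha> x < \<epsilon> / 2) at_bot"
      by (rule order_tendstoD(2)[OF \<alpha>.cdf_lim_at_bot]) (use \<open>\<epsilon> > 0\<close> in simp)
    moreover have "eventually (\<lambda>x. x < 0) (at_bot :: real filter)"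
      by (rule eventually_gt_at_bot)
    ultimately obtain a where a: "cdf \<alpha> a < \<epsilon> / 2" "a < 0"
      using eventually_happens'[OF trivial_limit_at_bot_linorder eventually_conj] by blast
    have "eventually (\<lambda>x. cdf \<beta> x > 1 - \<epsilon> / 2) at_top"
      by (rule order_tendstoD(1)[OF \<beta>.cdf_lim_at_top_prob]) (use \<open>\<epsilon> > 0\<close> in simp)
    moreover have "eventually (\<lambda>x. x > 0) (at_top :: real filter)"
      by (rule eventually_gt_at_top)
    ultimately obtain b where b: "cdf \<beta> b > 1 - \<epsilon> / 2" "b > 0"
      using eventually_happens'[OF trivial_limit_at_top_linorder eventually_conj] by blast
    have "measure (\<sigma> n) {a<..b} > 1 - \<epsilon>" for n
      using \<sigma>.cdf_diff_eq[of a b n] a b le\<alpha>[of n a] le\<beta>[of b n] by simp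
    then show "\<exists>a b. a < b \<and> (\<forall>n. 1 - \<epsilon> < measure (\<sigma> n) {a<..b})"
      using a b by (meson less_trans)
  qed (rule \<sigma>.real_distribution_axioms)
  from tight_imp_convergent_subsubsequence[OF this strict_mono_id]
  obtain r \<rho> where r: "strict_mono r" and \<rho>: "real_distribution \<rho>"
    and conv: "weak_conv_m (\<sigma> \<circ> r) \<rho>"
    by auto
  interpret \<rho>: real_distribution \<rho> by fact
  note [measurable] = \<alpha>.real_distribution_axioms[THEN measurable_cdf]
    \<beta>.real_distribution_axioms[THEN measurable_cdf] \<rho>[THEN measurable_cdf]
    \<sigma>.real_distribution_axioms[THEN measurable_cdf]
  define cost where "cost F G p = indicator {p. fst p < snd p} p *
     (ennreal (F (fst p) - G (snd p)) + ennreal (G (fst p) - F (snd p)))"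
    for F G :: "real \<Rightarrow> real" and p :: "real \<times> real"
  have cost_eq: "quantile_cost \<mu> \<nu> = 2 * (\<integral>\<^sup>+ p. cost (cdf \<mu>) (cdf \<nu>) p \<partial>(lborel \<Otimes>\<^sub>M lborel))"
    if "real_distribution \<mu>" "real_distribution \<nu>" for \<mu> \<nu>
    using that by (simp add: quantile_cost_eq_cdf_cost cdf_cost_def cost_def)
  have measurable_cost [measurable]: "cost F G \<in> borel_measurable (lborel \<Otimes>\<^sub>M lborel)"
    if [measurable]: "F \<in> borel_measurable borel" "G \<in> borel_measurable borel" for F G
  proof -
    have "{p \<in> space (borel \<Otimes>\<^sub>M borel). fst p < (snd p :: real)} \<in> sets (borel \<Otimes>\<^sub>M borel)"
      by measurable
    then have [measurable]: "{p. fst p < (snd p :: real)} \<in> sets (borel \<Otimes>\<^sub>M borel)"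
      by (simp add: space_pair_measure)
    show ?thesis unfolding cost_def[abs_def] by measurable
  qed
  \<comment> \<open>For distribution functions between those of \<open>\<beta>\<close> and
    \<open>\<alpha>\<close>, each of the two summands is at most \<open>cdf \<alpha>\<close> at the
    first coordinate minus \<open>cdf \<beta>\<close> at the second; hence the factor 2.\<close>
  have cost_le: "cost F G p \<le> 2 * cost (cdf \<alpha>) (cdf \<beta>) p"
    if "\<And>x. x \<in> {fst p, snd p} \<Longrightarrow> F x \<in> {cdf \<beta> x..cdf \<alpha> x} \<and> G x \<in> {cdf \<beta> x..cdf \<alpha> x}" for F G p
  proof -
    have "ennreal (F (fst p) - G (snd p)) \<le> ennreal (cdf \<alpha> (fst p) - cdf \<beta> (snd p))"
      "ennreal (G (fst p) - F (snd p)) \<le> ennreal (cdf \<alpha> (fst p) - cdf \<beta> (snd p))"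
      using that[of "fst p"] that[of "snd p"] by (auto intro!: ennreal_leI)
    then have "ennreal (F (fst p) - G (snd p)) + ennreal (G (fst p) - F (snd p)) \<le>
        2 * (ennreal (cdf \<alpha> (fst p) - cdf \<beta> (snd p)) + ennreal (cdf \<beta> (fst p) - cdf \<alpha> (snd p)))"
      by (simp add: mult_2 add_mono distrib_left add_increasing2)
    then show ?thesis
      unfolding cost_def by (auto simp: indicator_def)
  qed
  have cost_fin: "(\<integral>\<^sup>+ p. 2 * cost (cdf \<alpha>) (cdf \<beta>) p \<partial>(lborel \<Otimes>\<^sub>M lborel)) < \<infinity>"
    using quantile_cost_less_top[OF \<alpha>(1) \<beta>(1)]
    by (simp add: cost_eq \<alpha>.real_distribution_axioms \<beta>.real_distribution_axioms nn_integral_cmult)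
  \<comment> \<open>These are the atoms of the limit: a countable set, outside of which
    \<open>cdf \<rho>\<close> is continuous and weak convergence is pointwise.\<close>
  define A where "A = {x. measure \<rho> {x} > 0}"
  have AE: "AE p in lborel \<Otimes>\<^sub>M lborel. fst p \<notin> A \<and> snd p \<notin> A"
    unfolding A_def by (intro AE_lborel_pair_countable \<rho>.countable_atoms)
  have lim: "(\<lambda>n. cdf (\<sigma> (r n)) x) \<longlonglongrightarrow> cdf \<rho> x" if "x \<notin> A" for x
    using conv that measure_nonneg[of \<rho> "{x}"]
    by (auto simp: weak_conv_m_def weak_conv_def \<rho>.isCont_cdf A_def less_le)
  have between: "cdf \<rho> x \<in> {cdf \<beta> x..cdf \<alpha> x}" if "x \<notin> A" for x
    using le\<alpha> le\<beta> LIMSEQ_le_const[OF lim[OF that]] LIMSEQ_le_const2[OF lim[OF that]] by auto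
  have "\<rho> \<in> P2"
  proof -
    have "(\<integral>\<^sup>+ p. cost (cdf \<alpha>) (cdf \<rho>) p \<partial>(lborel \<Otimes>\<^sub>M lborel)) \<le>
        (\<integral>\<^sup>+ p. 2 * cost (cdf \<alpha>) (cdf \<beta>) p \<partial>(lborel \<Otimes>\<^sub>M lborel))"
    proof (rule nn_integral_mono_AE, use AE in eventually_elim)
      fix p :: "real \<times> real" assume "fst p \<notin> A \<and> snd p \<notin> A"
      then show "cost (cdf \<alpha>) (cdf \<rho>) p \<le> 2 * cost (cdf \<alpha>) (cdf \<beta>) p"
        using between order_trans[OF le\<beta> le\<alpha>] by (intro cost_le) auto
    qed
    from le_less_trans[OF this cost_fin] have fin: "quantile_cost \<alpha> \<rho> < \<infinity>"
      using \<alpha>.real_distribution_axioms \<rho>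
      by (simp add: cost_eq ennreal_mult_less_top)
    note [measurable] = \<alpha>.real_distribution_axioms[THEN measurable_quantile] \<rho>[THEN measurable_quantile]
    \<comment> \<open>The quantile function of \<open>\<rho>\<close> is that of
      \<open>\<alpha>\<close> minus a square integrable difference, hence square integrable
      itself.\<close>
    have "(\<integral>\<^sup>+ u. ennreal ((quantile \<alpha> u - (quantile \<alpha> u - quantile \<rho> u))\<^sup>2) \<partial>unit_interval) < \<infinity>"
      by (rule nn_integral_power2_diff_less_top)
        (use fin \<alpha>(1) in \<open>simp_all add: P2_iff_quantile quantile_cost_def\<close>)
    then show ?thesis
      using \<rho> by (simp add: P2_iff_quantile)
  qed
  moreover have "(\<lambda>n. W2 (\<sigma> (r n)) \<rho>) \<longlonglongrightarrow> 0"
  proof -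
    have "(\<lambda>n. \<integral>\<^sup>+ p. cost (cdf (\<sigma> (r n))) (cdf \<rho>) p \<partial>(lborel \<Otimes>\<^sub>M lborel)) \<longlonglongrightarrow>
        (\<integral>\<^sup>+ p. 0 \<partial>(lborel \<Otimes>\<^sub>M lborel :: (real \<times> real) measure))"
    proof (rule nn_integral_dominated_convergence[OF _ _ _ _ cost_fin])
      show "AE p in lborel \<Otimes>\<^sub>M lborel. cost (cdf (\<sigma> (r n))) (cdf \<rho>) p \<le> 2 * cost (cdf \<alpha>) (cdf \<beta>) p" for n
        using AE
      proof eventually_elim
        fix p :: "real \<times> real" assume "fst p \<notin> A \<and> snd p \<notin> A"
        then show "cost (cdf (\<sigma> (r n))) (cdf \<rho>) p \<le> 2 * cost (cdf \<alpha>) (cdf \<beta>) p"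
          using between le\<beta> le\<alpha> by (intro cost_le) auto
      qed
      show "AE p in lborel \<Otimes>\<^sub>M lborel. (\<lambda>n. cost (cdf (\<sigma> (r n))) (cdf \<rho>) p) \<longlonglongrightarrow> 0"
        using AE
      proof eventually_elim
        fix p :: "real \<times> real" assume p: "fst p \<notin> A \<and> snd p \<notin> A"
        show "(\<lambda>n. cost (cdf (\<sigma> (r n))) (cdf \<rho>) p) \<longlonglongrightarrow> 0"
        proof (cases "fst p < snd p")
          case True
          have "(\<lambda>n. ennreal (cdf (\<sigma> (r n)) (fst p) - cdf \<rho> (snd p)) +
                ennreal (cdf \<rho> (fst p) - cdf (\<sigma> (r n)) (snd p))) \<longlonglongrightarrow>
              ennreal (cdf \<rho> (fst p) - cdf \<rho> (snd p)) + ennreal (cdf \<rho> (fst p) - cdf \<rho> (snd p))"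
            using p by (intro tendsto_add tendsto_ennrealI tendsto_diff tendsto_const lim) auto
          moreover have "cdf \<rho> (fst p) \<le> cdf \<rho> (snd p)"
            using True by (intro \<rho>.cdf_nondecreasing) simp
          ultimately show ?thesis
            using True by (simp add: cost_def ennreal_neg)
        qed (simp add: cost_def)
      qed
    qed measurable
    then have "(\<lambda>n. 2 * (\<integral>\<^sup>+ p. cost (cdf (\<sigma> (r n))) (cdf \<rho>) p \<partial>(lborel \<Otimes>\<^sub>M lborel))) \<longlonglongrightarrow> 2 * 0"
      by (intro ennreal_tendsto_cmult) auto
    then have "(\<lambda>n. quantile_cost (\<sigma> (r n)) \<rho>) \<longlonglongrightarrow> 0"
      by (simp add: cost_eq \<sigma>.real_distribution_axioms \<rho>)
    then have "(\<lambda>n. sqrt (enn2real (quantile_cost (\<sigma> (r n)) \<rho>))) \<longlonglongrightarrow> sqrt (enn2real 0)"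
      by (intro tendsto_real_sqrt tendsto_enn2real) auto
    then show ?thesis
      by (simp add: W2_eq_quantile_cost \<sigma>.real_distribution_axioms \<rho>)
  qed
  ultimately show ?thesis
    using r by blast
qed

section \<open>Limit sets\<close>

lemma st_lower_boundD: "st_lower_bound \<mu> A \<Longrightarrow> \<rho> \<in> A \<Longrightarrow> \<mu> \<le>\<^sub>s\<^sub>t \<rho>"
  by (simp add: st_lower_bound_def)

lemma st_upper_boundD: "st_upper_bound \<mu> A \<Longrightarrow> \<rho> \<in> A \<Longrightarrow> \<rho> \<le>\<^sub>s\<^sub>t \<mu>"
  by (simp add: st_upper_bound_def)

lemma closed_order_bounded_sequentially_compact:
  assumes "closedin W2_topology K" "order_bounded K" "\<And>n. x n \<in> K"
  obtains r :: "nat \<Rightarrow> nat" and k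
  where "strict_mono r" "k \<in> K" "(\<lambda>n. W2 (x (r n)) k) \<longlonglongrightarrow> 0"
proof -
  have "K \<subseteq> P2"
    using closedin_subset[OF assms(1)] by simp
  then have x: "x n \<in> P2" for n
    using assms(3) by blast
  obtain \<alpha> \<beta> where "\<alpha> \<in> P2" "st_lower_bound \<alpha> K" "\<beta> \<in> P2" "st_upper_bound \<beta> K"
    using assms(2) by (auto simp: order_bounded_def)
  then have "\<exists>r \<rho>. strict_mono (r :: nat \<Rightarrow> nat) \<and> \<rho> \<in> P2 \<and> (\<lambda>n. W2 (x (r n)) \<rho>) \<longlonglongrightarrow> 0"
    using x assms(3)
    by (intro order_bounded_sequentially_compact[of x \<alpha> \<beta>]) (auto intro: st_lower_boundD st_upper_boundD)
  then obtain r \<rho> where r: "strict_mono (r :: nat \<Rightarrow> nat)"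
    and \<rho>: "\<rho> \<in> P2" "(\<lambda>n. W2 (x (r n)) \<rho>) \<longlonglongrightarrow> 0"
    by blast
  then have "limitin W2_topology (\<lambda>n. x (r n)) \<rho> sequentially"
    using x by (simp add: W2.limitin_metric_dist_null)
  moreover have "range (\<lambda>n. x (r n)) \<subseteq> K"
    using assms(3) by auto
  \<comment> \<open>The order bounds provide a limit in \<open>P2\<close>; closedness keeps it in
    \<open>K\<close>.\<close>
  ultimately have "\<rho> \<in> K"
    using assms(1) unfolding W2.metric_closedin_iff_sequentially_closed by blast
  then show ?thesis
    using r \<rho>(2) that by blast
qed

section \<open>Continuity and composition for a single semiflow\<close>

context
  fixes P :: "real \<Rightarrow> real measure \<Rightarrow> real measure"
  assumes semiflow: "semiflow P"
begin

lemma semiflow_continuous: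
  assumes "0 \<le> t"
  shows "continuous_map W2_topology W2_topology (P t)"
proof -
  have "continuous_map W2_topology (prod_topology (top_of_set {0..}) W2_topology) (\<lambda>\<mu>. (t, \<mu>))"
    using assms by (intro continuous_map_pairedI) auto
  then have "continuous_map W2_topology W2_topology ((\<lambda>(t, \<mu>). P t \<mu>) \<circ> (\<lambda>\<mu>. (t, \<mu>)))"
    using semiflow unfolding semiflow_def by (blast intro: continuous_map_compose)
  then show ?thesis
    by (simp add: comp_def)
qed

lemma semiflow_P2:
  assumes "0 \<le> t" "\<mu> \<in> P2"
  shows "P t \<mu> \<in> P2"
  using continuous_map_image_subset_topspace[OF semiflow_continuous[OF assms(1)]] assms(2) by auto

lemma semiflow_tendsto:
  assumes "0 \<le> t" "\<And>n. x n \<in> P2" "z \<in> P2" "(\<lambda>n. W2 (x n) z) \<longlonglongrightarrow> 0"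
  shows "(\<lambda>n. W2 (P t (x n)) (P t z)) \<longlonglongrightarrow> 0"
proof -
  have "limitin W2_topology x z sequentially"
    using assms by (simp add: W2.limitin_metric_dist_null)
  then have "limitin W2_topology (P t \<circ> x) (P t z) sequentially"
    by (rule continuous_map_limit[OF semiflow_continuous[OF assms(1)]])
  then show ?thesis
    by (simp add: W2.limitin_metric_dist_null comp_def)
qed

lemma semiflow_add:
  assumes "0 \<le> t" "0 \<le> s" "\<mu> \<in> P2"
  shows "P t (P s \<mu>) = P (t + s) \<mu>"
  using semiflow assms by (simp add: semiflow_def)

end

text \<open>Positive invariance keeps the orbits of \<open>B\<close> inside \<open>P2\<close>, so
  membership in a metric ball reduces to the distance inequality.\<close>

lemma mem_omega_limit_iff:
  assumes "B \<subseteq> P2" "positively_invariant P B"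
  shows "y \<in> omega_limit P B \<longleftrightarrow>
    y \<in> P2 \<and> (\<forall>s\<ge>0. \<forall>e>0. \<exists>t\<ge>s. \<exists>b\<in>B. W2 y (P t b) < e)"
proof -
  have P2: "P t b \<in> P2" if "0 \<le> t" "b \<in> B" for t b
    using assms that unfolding positively_invariant_def by blast
  have "y \<in> W2_topology closure_of (\<Union>t\<in>{s..}. P t ` B) \<longleftrightarrow>
      y \<in> P2 \<and> (\<forall>e>0. \<exists>t\<ge>s. \<exists>b\<in>B. W2 y (P t b) < e)" if "0 \<le> s" for s
    unfolding W2.metric_closure_of mem_Collect_eq
  proof (intro conj_cong refl all_cong)
    fix e :: real assume "y \<in> P2"
    then show "(\<exists>z\<in>\<Union>t\<in>{s..}. P t ` B. z \<in> W2.mball y e) \<longleftrightarrow> (\<exists>t\<ge>s. \<exists>b\<in>B. W2 y (P t b) < e)"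
      using P2[OF order_trans[OF \<open>0 \<le> s\<close>]] by auto
  qed
  then show ?thesis
    unfolding omega_limit_def by (auto intro: order_refl)
qed

context
  fixes P :: "real \<Rightarrow> real measure \<Rightarrow> real measure" and B K :: "real measure set"
  assumes semiflow: "semiflow P" and order_preserving: "order_preserving P"
    and B: "B \<subseteq> P2" "positively_invariant P B"
    and K: "closedin W2_topology K" "order_bounded K"
    and attracts: "attracts P K B"
begin

lemma orbit_mem: "0 \<le> t \<Longrightarrow> b \<in> B \<Longrightarrow> P t b \<in> B"
  using B(2) by (auto simp: positively_invariant_def)

lemma orbit_P2: "0 \<le> t \<Longrightarrow> b \<in> B \<Longrightarrow> P t b \<in> P2"
  using orbit_mem B(1) by blast

lemma omega_limit_P2: "z \<in> omega_limit P B \<Longrightarrow> z \<in> P2"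
  by (simp add: mem_omega_limit_iff[OF B])

text \<open>Attraction supplies points of \<open>K\<close> ever closer to the orbit points. A
  convergent subsequence of them drags the orbit points along, and since the times diverge the limit
  lies in the omega limit set.\<close>

lemma asymptotically_compact:
  fixes \<tau> :: "nat \<Rightarrow> real"
  assumes \<tau>: "filterlim \<tau> at_top sequentially" "\<And>n. 0 \<le> \<tau> n" and b: "\<And>n. b n \<in> B"
  obtains r :: "nat \<Rightarrow> nat" and z
  where "strict_mono r" "z \<in> omega_limit P B" "(\<lambda>n. W2 (P (\<tau> (r n)) (b (r n))) z) \<longlonglongrightarrow> 0"
proof -
  define y where "y n = P (\<tau> n) (b n)" for n
  have y: "y n \<in> P2" for n
    unfolding y_def by (rule orbit_P2[OF \<tau>(2) b])
  define g where "g n = W2_sets (P (\<tau> n) ` B) K" for n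
  have INF_le: "(INF k\<in>K. ennreal (W2 (y n) k)) \<le> g n" for n
    unfolding g_def W2_sets_def y_def by (rule SUP_upper) (use b in blast)
  have g: "g \<longlonglongrightarrow> 0"
    unfolding g_def using filterlim_compose[OF attracts[unfolded attracts_def] \<tau>(1)] .
  then have ev: "\<forall>\<^sub>F n in sequentially. g n < \<infinity>"
    by (rule order_tendstoD) simp
  then obtain N where "g N < \<infinity>"
    using eventually_happens' sequentially_bot by blast
  \<comment> \<open>An infimum over the empty set would be infinite.\<close>
  with INF_le[of N] have "K \<noteq> {}"
    by auto
  \<comment> \<open>The slack \<open>1 / Suc n\<close> replaces attainment of the infimum. While
    \<open>g n\<close> is infinite any point of \<open>K\<close> is accepted, which concerns only
    finitely many \<open>n\<close>.\<close>
  have "\<exists>k\<in>K. g n < \<infinity> \<longrightarrow> ennreal (W2 (y n) k) < g n + ennreal (1 / Suc n)" for n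
  proof (cases "g n < \<infinity>")
    case True
    then have "g n < g n + ennreal (1 / Suc n)"
      by (cases "g n") (auto simp: ennreal_plus[symmetric] simp del: ennreal_plus
          intro!: ennreal_lessI add_nonneg_pos)
    with INF_le[of n] have "(INF k\<in>K. ennreal (W2 (y n) k)) < g n + ennreal (1 / Suc n)"
      by (rule le_less_trans)
    then show ?thesis
      by (auto simp: INF_less_iff)
  qed (use \<open>K \<noteq> {}\<close> in blast)
  then obtain k where k: "\<And>n. k n \<in> K"
    and less: "\<And>n. g n < \<infinity> \<Longrightarrow> ennreal (W2 (y n) (k n)) < g n + ennreal (1 / Suc n)"
    by metis
  have kP2: "k n \<in> P2" for n
    using k closedin_subset[OF K(1)] by auto
  have "(\<lambda>n. g n + ennreal (1 / Suc n)) \<longlonglongrightarrow> 0 + ennreal 0"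
    by (intro tendsto_add g tendsto_ennrealI LIMSEQ_Suc[OF lim_const_over_n])
  then have bound: "(\<lambda>n. g n + ennreal (1 / Suc n)) \<longlonglongrightarrow> ennreal 0"
    by simp
  have "\<forall>\<^sub>F n in sequentially. ennreal (W2 (y n) (k n)) \<le> g n + ennreal (1 / Suc n)"
    using ev by (rule eventually_mono) (intro less_imp_le less)
  then have "(\<lambda>n. ennreal (W2 (y n) (k n))) \<longlonglongrightarrow> ennreal 0"
    by (rule tendsto_sandwich[OF always_eventually _ tendsto_const bound, rotated]) simp
  then have yk: "(\<lambda>n. W2 (y n) (k n)) \<longlonglongrightarrow> 0"
    by (rule tendsto_ennrealD) (simp_all add: W2_nonneg)
  obtain r z where r: "strict_mono r" and z: "z \<in> K" "(\<lambda>n. W2 (k (r n)) z) \<longlonglongrightarrow> 0"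
    using closed_order_bounded_sequentially_compact[OF K, of k] k by blast
  have zP2: "z \<in> P2"
    using z closedin_subset[OF K(1)] by auto
  have "(\<lambda>n. W2 (y (r n)) (k (r n)) + W2 (k (r n)) z) \<longlonglongrightarrow> 0"
    using tendsto_add[OF LIMSEQ_subseq_LIMSEQ[OF yk r] z(2)] by (simp add: comp_def)
  then have lim: "(\<lambda>n. W2 (y (r n)) z) \<longlonglongrightarrow> 0"
    by (rule tendsto_sandwich[OF always_eventually always_eventually tendsto_const, rotated 2])
      (auto simp: W2_nonneg intro!: W2.triangle y kP2 zP2)
  have "z \<in> omega_limit P B"
    unfolding mem_omega_limit_iff[OF B]
  proof (intro conjI allI impI)
    fix s e :: real assume "0 < e"
    then have "\<forall>\<^sub>F n in sequentially. W2 (y (r n)) z < e"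
      using lim by (intro order_tendstoD)
    moreover have "\<forall>\<^sub>F n in sequentially. s \<le> \<tau> (r n)"
      using filterlim_compose[OF \<tau>(1) filterlim_subseq[OF r]] by (auto simp: filterlim_at_top)
    ultimately obtain n where "W2 (y (r n)) z < e" "s \<le> \<tau> (r n)"
      using eventually_happens' eventually_conj sequentially_bot by blast
    then show "\<exists>t\<ge>s. \<exists>b\<in>B. W2 z (P t b) < e"
      using b unfolding y_def by (metis W2.commute)
  qed (rule zP2)
  then show ?thesis
    using that r lim unfolding y_def by blast
qed

text \<open>Approximate \<open>y\<close> by orbit points, stop each orbit \<open>t\<close> earlier,
  and take an accumulation point \<open>z\<close> of the earlier points. Continuity of
  \<open>P t\<close> sends \<open>z\<close> to \<open>y\<close>.\<close>

lemma omega_limit_preimage: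
  assumes "y \<in> omega_limit P B" "0 \<le> t"
  obtains z where "z \<in> omega_limit P B" "P t z = y"
proof -
  \<comment> \<open>Asking for times beyond \<open>real n + t\<close> keeps the shortened times
    \<open>s n - t\<close> nonnegative and divergent.\<close>
  have "\<exists>s b. real n + t \<le> s \<and> b \<in> B \<and> W2 y (P s b) < 1 / Suc n" for n
  proof -
    have "\<exists>s\<ge>real n + t. \<exists>b\<in>B. W2 y (P s b) < 1 / Suc n"
      using assms unfolding mem_omega_limit_iff[OF B] by simp
    then show ?thesis by blast
  qed
  then obtain s b where s: "\<And>n. real n + t \<le> s n" and b: "\<And>n. b n \<in> B"
    and less: "\<And>n. W2 y (P (s n) (b n)) < 1 / Suc n"
    by metis
  have nonneg: "0 \<le> s n - t" for n
    using s[of n] by (simp add: algebra_simps add_increasing)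
  have "filterlim (\<lambda>n. s n - t) at_top sequentially"
    by (rule filterlim_at_top_mono[OF filterlim_real_sequentially])
      (use s in \<open>auto simp: algebra_simps\<close>)
  then obtain r z where r: "strict_mono r" and z: "z \<in> omega_limit P B"
    and lim: "(\<lambda>n. W2 (P (s (r n) - t) (b (r n))) z) \<longlonglongrightarrow> 0"
    using asymptotically_compact[of "\<lambda>n. s n - t" b] nonneg b by blast
  have P2: "z \<in> P2" "y \<in> P2" "P t z \<in> P2" "P (s n) (b n) \<in> P2" for n
    using z assms omega_limit_P2 semiflow_P2[OF semiflow] orbit_P2[OF _ b] order_trans[OF \<open>0 \<le> t\<close>] nonneg[of n]
    by simp_all
  have "(\<lambda>n. W2 (P t (P (s (r n) - t) (b (r n)))) (P t z)) \<longlonglongrightarrow> 0"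
    using nonneg b by (intro semiflow_tendsto[OF semiflow \<open>0 \<le> t\<close>] lim orbit_P2 P2) auto
  moreover have "P t (P (s n - t) (b n)) = P (s n) (b n)" for n
    using semiflow_add[OF semiflow \<open>0 \<le> t\<close> nonneg, of "b n" n] b B by auto
  ultimately have "(\<lambda>n. W2 (P (s (r n)) (b (r n))) (P t z)) \<longlonglongrightarrow> 0"
    by simp
  moreover have "(\<lambda>n. W2 y (P (s n) (b n))) \<longlonglongrightarrow> 0"
    by (rule tendsto_sandwich[OF always_eventually always_eventually tendsto_const
          LIMSEQ_Suc[OF lim_const_over_n[of 1]]])
      (use less in \<open>simp_all add: W2_nonneg less_imp_le\<close>)
  then have "(\<lambda>n. W2 y (P (s (r n)) (b (r n)))) \<longlonglongrightarrow> 0"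
    using LIMSEQ_subseq_LIMSEQ[OF _ r] by (force simp: comp_def)
  ultimately have "(\<lambda>n. W2 y (P (s (r n)) (b (r n))) + W2 (P (s (r n)) (b (r n))) (P t z)) \<longlonglongrightarrow> 0 + 0"
    by (intro tendsto_add)
  \<comment> \<open>The same orbit points tend to both \<open>y\<close> and \<open>P t z\<close>,
    which forces these to coincide.\<close>
  then have "W2 y (P t z) \<le> 0"
    by (intro LIMSEQ_le_const[where X = "\<lambda>n. W2 y (P (s (r n)) (b (r n))) + W2 (P (s (r n)) (b (r n))) (P t z)"])
      (auto intro!: W2.triangle P2)
  then have "P t z = y"
    using P2 W2.zero W2_nonneg by (metis antisym)
  then show ?thesis
    using that z by blast
qed

text \<open>Every limit point has the form \<open>P t z\<close> with \<open>z\<close> again a limit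
  point, so order preservation can be applied to \<open>\<mu>\<close> and \<open>z\<close>. Time is
  positive as in \<open>order_preserving\<close>.\<close>

lemma st_lower_bound_omega_limit:
  assumes "st_lower_bound \<mu> (omega_limit P B)" "\<mu> \<in> P2" "0 < t"
  shows "st_lower_bound (P t \<mu>) (omega_limit P B)"
  unfolding st_lower_bound_def
proof
  fix y assume "y \<in> omega_limit P B"
  then obtain z where z: "z \<in> omega_limit P B" "P t z = y"
    using assms(3) by (metis omega_limit_preimage less_imp_le)
  then show "P t \<mu> \<le>\<^sub>s\<^sub>t y"
    using order_preserving assms omega_limit_P2 unfolding order_preserving_def st_lower_bound_def
    by blast
qed

lemma st_upper_bound_omega_limit:
  assumes "st_upper_bound \<mu> (omega_limit P B)" "\<mu> \<in> P2" "0 < t"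
  shows "st_upper_bound (P t \<mu>) (omega_limit P B)"
  unfolding st_upper_bound_def
proof
  fix y assume "y \<in> omega_limit P B"
  then obtain z where z: "z \<in> omega_limit P B" "P t z = y"
    using assms(3) by (metis omega_limit_preimage less_imp_le)
  then show "y \<le>\<^sub>s\<^sub>t P t \<mu>"
    using order_preserving assms omega_limit_P2 unfolding order_preserving_def st_upper_bound_def
    by blast
qed

text \<open>Otherwise there would be orbit points at arbitrarily late times at distance at least
  \<open>e\<close> from \<open>\<mu>\<^sub>0\<close>; asymptotic compactness would give them an
  accumulation point in the omega limit set, which can only be \<open>\<mu>\<^sub>0\<close>.\<close>

lemma attracts_of_omega_limit_subset:
  assumes "omega_limit P B \<subseteq> {\<mu>\<^sub>0}"
  shows "attracts P {\<mu>\<^sub>0} B"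
proof -
  have "\<exists>T\<ge>0. \<forall>t\<ge>T. \<forall>b\<in>B. W2 (P t b) \<mu>\<^sub>0 < e" if "0 < e" for e
  proof (rule ccontr)
    assume contr: "\<not> ?thesis"
    have "\<exists>t b. real n \<le> t \<and> b \<in> B \<and> e \<le> W2 (P t b) \<mu>\<^sub>0" for n
      using contr by (metis not_le of_nat_0_le_iff)
    then obtain \<tau> b where \<tau>: "\<And>n. real n \<le> \<tau> n" and b: "\<And>n. b n \<in> B"
      and ge: "\<And>n. e \<le> W2 (P (\<tau> n) (b n)) \<mu>\<^sub>0"
      by metis
    have "filterlim \<tau> at_top sequentially"
      by (rule filterlim_at_top_mono[OF filterlim_real_sequentially]) (simp add: \<tau>)
    moreover have "0 \<le> \<tau> n" for n
      using \<tau>[of n] by (rule order_trans[rotated]) simp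
    ultimately obtain r z where "strict_mono r" "z \<in> omega_limit P B"
      and lim: "(\<lambda>n. W2 (P (\<tau> (r n)) (b (r n))) z) \<longlonglongrightarrow> 0"
      using asymptotically_compact[of \<tau> b] b by blast
    then have "z = \<mu>\<^sub>0" using assms by auto
    then have "e \<le> 0"
      using ge by (intro LIMSEQ_le_const[OF lim]) auto
    with \<open>0 < e\<close> show False by simp
  qed
  note unif = this
  show ?thesis
    unfolding attracts_def
  proof (rule order_tendstoI)
    fix a :: ennreal assume "0 < a"
    \<comment> \<open>The bound \<open>a\<close> may be infinite. The intermediate \<open>c\<close>
      is finite and leaves room for the supremum, which turns strict bounds into weak ones.\<close>
    then obtain c where c: "0 < c" "c < a"
      using dense by blast
    then obtain e where e: "0 < e" "ennreal e < a"
      by (cases c) auto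
    obtain T where T: "\<forall>t\<ge>T. \<forall>b\<in>B. W2 (P t b) \<mu>\<^sub>0 < e"
      using unif[OF e(1)] by blast
    have "W2_sets (P t ` B) {\<mu>\<^sub>0} \<le> ennreal e" if "T \<le> t" for t
      unfolding W2_sets_def
      by (rule SUP_least) (use T that in \<open>auto simp: ennreal_leI less_imp_le\<close>)
    then show "\<forall>\<^sub>F t in at_top. W2_sets (P t ` B) {\<mu>\<^sub>0} < a"
      using e(2) by (auto simp: eventually_at_top_linorder intro: le_less_trans)
  qed simp
qed

lemma attracts_of_squeeze:
  assumes \<alpha>: "\<And>n. \<alpha> n \<in> P2" "(\<lambda>n. W2 (\<alpha> n) \<mu>\<^sub>0) \<longlonglongrightarrow> 0"
    "\<And>n. st_lower_bound (\<alpha> n) (omega_limit P B)"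
    and \<beta>: "\<And>n. \<beta> n \<in> P2" "(\<lambda>n. W2 (\<beta> n) \<mu>\<^sub>0) \<longlonglongrightarrow> 0"
    "\<And>n::nat. st_upper_bound (\<beta> n) (omega_limit P B)"
    and \<mu>\<^sub>0: "\<mu>\<^sub>0 \<in> P2"
  shows "attracts P {\<mu>\<^sub>0} B"
proof (rule attracts_of_omega_limit_subset, rule subsetI)
  fix \<rho> assume \<rho>: "\<rho> \<in> omega_limit P B"
  then have \<rho>P2: "\<rho> \<in> P2" by (rule omega_limit_P2)
  \<comment> \<open>The squeeze controls the distance to \<open>\<alpha> n\<close>, not directly to
    \<open>\<mu>\<^sub>0\<close>. The detour through \<open>\<alpha> n\<close> makes its distance to
    \<open>\<mu>\<^sub>0\<close> appear twice.\<close>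
  have "W2 \<rho> \<mu>\<^sub>0 \<le> (W2 (\<beta> n) \<mu>\<^sub>0 + W2 (\<alpha> n) \<mu>\<^sub>0) + W2 (\<alpha> n) \<mu>\<^sub>0" for n
  proof -
    have "W2 \<rho> (\<alpha> n) \<le> W2 (\<beta> n) (\<alpha> n)"
      by (intro W2_le_of_between \<alpha> \<beta> \<rho>P2 st_lower_boundD[OF \<alpha>(3) \<rho>] st_upper_boundD[OF \<beta>(3) \<rho>])
    moreover have "W2 \<rho> \<mu>\<^sub>0 \<le> W2 \<rho> (\<alpha> n) + W2 (\<alpha> n) \<mu>\<^sub>0"
      by (intro W2.triangle \<rho>P2 \<alpha> \<mu>\<^sub>0)
    moreover have "W2 (\<beta> n) (\<alpha> n) \<le> W2 (\<beta> n) \<mu>\<^sub>0 + W2 (\<alpha> n) \<mu>\<^sub>0"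
      using W2.triangle[OF \<beta>(1) \<mu>\<^sub>0 \<alpha>(1)] by (simp add: W2.commute)
    ultimately show ?thesis by simp
  qed
  moreover have "(\<lambda>n. (W2 (\<beta> n) \<mu>\<^sub>0 + W2 (\<alpha> n) \<mu>\<^sub>0) + W2 (\<alpha> n) \<mu>\<^sub>0) \<longlonglongrightarrow> (0 + 0) + 0"
    by (intro tendsto_add \<alpha> \<beta>)
  ultimately have "W2 \<rho> \<mu>\<^sub>0 \<le> 0"
    by (intro LIMSEQ_le_const) auto
  then show "\<rho> \<in> {\<mu>\<^sub>0}"
    using \<rho>P2 \<mu>\<^sub>0 W2.zero W2_nonneg by (metis antisym singletonI)
qed

end

text \<open>The flow started at any point of the orbit follows the orbit. Sampling at
  \<open>Suc n\<close> instead of \<open>n\<close> keeps the times strictly positive, as the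
  transport of order bounds demands.\<close>

lemma connecting_orbit_tail:
  assumes "connecting_orbit P \<alpha> \<beta> \<nu>"
  shows "\<nu> s \<in> P2" and "(\<lambda>n. W2 (P (real (Suc n)) (\<nu> s)) \<beta>) \<longlonglongrightarrow> 0"
proof -
  show "\<nu> s \<in> P2"
    using assms by (simp add: connecting_orbit_def)
  have "filterlim (\<lambda>n. real (Suc n) + s) at_top sequentially"
    by (rule filterlim_at_top_mono[OF filterlim_tendsto_add_at_top[OF tendsto_const[of s] filterlim_real_sequentially]]) auto
  moreover have "((\<lambda>t. W2 (\<nu> t) \<beta>) \<longlongrightarrow> 0) at_top"
    using assms by (simp add: connecting_orbit_def)
  ultimately have "(\<lambda>n. W2 (\<nu> (real (Suc n) + s)) \<beta>) \<longlonglongrightarrow> 0"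
    by (rule filterlim_compose[rotated])
  then show "(\<lambda>n. W2 (P (real (Suc n)) (\<nu> s)) \<beta>) \<longlonglongrightarrow> 0"
    using assms by (simp add: connecting_orbit_def del: of_nat_Suc)
qed

theorem theorem4p4:
  fixes P :: "real \<Rightarrow> real measure \<Rightarrow> real measure"
    and B K :: "real measure set"
    and \<mu>\<^sub>0 :: "real measure"
  assumes "semiflow P" and "order_preserving P"
    and "openin W2_topology B" and "W2_bounded B" and "positively_invariant P B"
    and "closedin W2_topology K" and "order_bounded K"
    and "attracts P K B"
    and "{\<mu> \<in> W2_topology closure_of B. invariant_measure P \<mu>} = {\<mu>\<^sub>0}"
  shows
    "(st_upper_bound \<mu>\<^sub>0 (omega_limit P B) \<and>
      (\<exists>\<mu> \<nu> s. invariant_measure P \<mu> \<and> \<mu> <\<^sub>s\<^sub>t \<mu>\<^sub>0 \<and>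
         connecting_orbit P \<mu> \<mu>\<^sub>0 \<nu> \<and> st_increasing \<nu> \<and>
         st_lower_bound (\<nu> s) (omega_limit P B))
      \<longrightarrow> attracts P {\<mu>\<^sub>0} B) \<and>
     (st_lower_bound \<mu>\<^sub>0 (omega_limit P B) \<and>
      (\<exists>\<mu> \<nu> s. invariant_measure P \<mu> \<and> \<mu>\<^sub>0 <\<^sub>s\<^sub>t \<mu> \<and>
         connecting_orbit P \<mu> \<mu>\<^sub>0 \<nu> \<and> st_decreasing \<nu> \<and>
         st_upper_bound (\<nu> s) (omega_limit P B))
      \<longrightarrow> attracts P {\<mu>\<^sub>0} B) \<and>
     ((\<exists>\<mu> \<nu> s. invariant_measure P \<mu> \<and> \<mu> <\<^sub>s\<^sub>t \<mu>\<^sub>0 \<and>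
         connecting_orbit P \<mu> \<mu>\<^sub>0 \<nu> \<and> st_increasing \<nu> \<and>
         st_lower_bound (\<nu> s) (omega_limit P B)) \<and>
      (\<exists>\<mu> \<nu> s. invariant_measure P \<mu> \<and> \<mu>\<^sub>0 <\<^sub>s\<^sub>t \<mu> \<and>
         connecting_orbit P \<mu> \<mu>\<^sub>0 \<nu> \<and> st_decreasing \<nu> \<and>
         st_upper_bound (\<nu> s) (omega_limit P B))
      \<longrightarrow> attracts P {\<mu>\<^sub>0} B)"
proof -
  have "B \<subseteq> P2"
    using openin_subset[OF assms(3)] by simp
  note hyps = assms(1,2) this assms(5-8)
  have "\<mu>\<^sub>0 \<in> P2"
    using assms(9) by (auto simp: invariant_measure_def)
  \<comment> \<open>In the two one-sided cases the constant sequence \<open>\<mu>\<^sub>0\<close> is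
    the second side of the squeeze.\<close>
  then have zero: "(\<lambda>n. W2 \<mu>\<^sub>0 \<mu>\<^sub>0) \<longlonglongrightarrow> 0"
    by (simp add: W2.zero)
  \<comment> \<open>The bound known at the single time \<open>s\<close> propagates to all the
    sampled later times.\<close>
  have lower: "P (real (Suc n)) (\<nu> s) \<in> P2 \<and>
      st_lower_bound (P (real (Suc n)) (\<nu> s)) (omega_limit P B)"
    if "connecting_orbit P \<mu> \<mu>\<^sub>0 \<nu>" "st_lower_bound (\<nu> s) (omega_limit P B)" for \<mu> \<nu> s n
    using connecting_orbit_tail(1)[OF that(1), of s] that(2)
    by (auto intro!: semiflow_P2[OF assms(1)] st_lower_bound_omega_limit[OF hyps])
  have upper: "P (real (Suc n)) (\<nu> s) \<in> P2 \<and>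
      st_upper_bound (P (real (Suc n)) (\<nu> s)) (omega_limit P B)"
    if "connecting_orbit P \<mu> \<mu>\<^sub>0 \<nu>" "st_upper_bound (\<nu> s) (omega_limit P B)" for \<mu> \<nu> s n
    using connecting_orbit_tail(1)[OF that(1), of s] that(2)
    by (auto intro!: semiflow_P2[OF assms(1)] st_upper_bound_omega_limit[OF hyps])
  note squeeze = attracts_of_squeeze[OF hyps _ _ _ _ _ _ \<open>\<mu>\<^sub>0 \<in> P2\<close>]
  show ?thesis
  proof (intro conjI impI; elim conjE exE)
    fix \<mu> \<nu> s
    assume "st_upper_bound \<mu>\<^sub>0 (omega_limit P B)" and orbit: "connecting_orbit P \<mu> \<mu>\<^sub>0 \<nu>"
      and "st_lower_bound (\<nu> s) (omega_limit P B)"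
    with \<open>\<mu>\<^sub>0 \<in> P2\<close> zero lower connecting_orbit_tail(2)[OF orbit, of s]
    show "attracts P {\<mu>\<^sub>0} B"
      by (intro squeeze[of "\<lambda>n. P (real (Suc n)) (\<nu> s)" "\<lambda>n. \<mu>\<^sub>0"]) blast+
  next
    fix \<mu> \<nu> s
    assume "st_lower_bound \<mu>\<^sub>0 (omega_limit P B)" and orbit: "connecting_orbit P \<mu> \<mu>\<^sub>0 \<nu>"
      and "st_upper_bound (\<nu> s) (omega_limit P B)"
    with \<open>\<mu>\<^sub>0 \<in> P2\<close> zero upper connecting_orbit_tail(2)[OF orbit, of s]
    show "attracts P {\<mu>\<^sub>0} B"
      by (intro squeeze[of "\<lambda>n. \<mu>\<^sub>0" "\<lambda>n. P (real (Suc n)) (\<nu> s)"]) blast+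
  next
    \<comment> \<open>With both orbits available, each one supplies one side of the squeeze.\<close>
    fix \<mu> \<nu> s \<mu>' \<nu>' s'
    assume orbit: "connecting_orbit P \<mu> \<mu>\<^sub>0 \<nu>" and "st_lower_bound (\<nu> s) (omega_limit P B)"
      and orbit': "connecting_orbit P \<mu>' \<mu>\<^sub>0 \<nu>'" and "st_upper_bound (\<nu>' s') (omega_limit P B)"
    with lower upper connecting_orbit_tail(2)[OF orbit, of s] connecting_orbit_tail(2)[OF orbit', of s']
    show "attracts P {\<mu>\<^sub>0} B"
      by (intro squeeze[of "\<lambda>n. P (real (Suc n)) (\<nu> s)" "\<lambda>n. P (real (Suc n)) (\<nu>' s')"]) blast+
  qed
qed

end
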